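(* Let $1\le p_1,p_2,p_3\le\infty$ and let $\Delta$ be the $K_3$-operator on $\mathbb F_q^2$. (i) If $\Delta(p_1,p_2,p_3)\lesssim 1$, then $$\frac{2}{p_1}+\frac{1}{p_2}+\frac{1}{p_3}\le 2,\qquad \frac{1}{p_1}+\frac{2}{p_2}+\frac{1}{p_3}\le 2,\qquad \frac{1}{p_1}+\frac{1}{p_2}+\frac{2}{p_3}\le 2.\qquad( * )$$ (ii) Conversely, if $(p_1,p_2,p_3)$ satisfies all three inequalities in $( * )$, then $\Delta(p_1,p_2,p_3)\lesssim 1$ for $(p_1,p_2,p_3)\ne(2,2,2)$, and $\Delta(2,2,2)\lessapprox 1$.
   Context: Conventions: $q$ ranges over powers of odd primes for which $3$ is a nonzero square in $\mathbb F_q$. For $x\in\mathbb F_q^2$ put $\|x\|=x_1^2+x_2^2$. For $t\in\mathbb F_q^*$, $S_t=\{x\in\mathbb F_q^2:\|x\|=t\}$, and $S_t(x)$ also denotes its indicator function. For $f:\mathbb F_q^2\to\mathbb R$: $\|f\|_p=(q^{-2}\sum_x|f(x)|^p)^{1/p}$ for $1\le p<\infty$ and $\|f\|_\infty=\max_x|f(x)|$. Exponents are extended real numbers, with $1/\infty=0$. The $K_3$-operator on $\mathbb F_q^2$ is $$\Delta(f_1,f_2,f_3)=\frac{1}{q^2|S_t|}\sum_{x^1,x^2,x^3\in\mathbb F_q^2}S_t(x^1-x^2)S_t(x^2-x^3)S_t(x^3-x^1)\prod_{i=1}^3f_i(x^i).$$ $\Delta(p_1,p_2,p_3)$ is the smallest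 constant such that $\Delta(f_1,f_2,f_3)\le\Delta(p_1,p_2,p_3)\prod_{i=1}^3\|f_i\|_{p_i}$ for all non-negative real-valued $f_i$. $\Delta(p_1,p_2,p_3)\lesssim1$ means there is a constant $C\ge 1$, independent of $q$ and $t$, with $\Delta(p_1,p_2,p_3)\le C$ for all such $q$ and all $t\in\mathbb F_q^*$. $\Delta(p_1,p_2,p_3)\lessapprox 1$ means that there is $C$ independent of $q,t$ such that $\Delta(1_E,1_F,1_H)\le C\|1_E\|_{p_1}\|1_F\|_{p_2}\|1_H\|_{p_3}$ for all subsets $E,F,H\subset\mathbb F_q^2$. *)

theory Defs
  imports "HOL-Algebra.Ring" "HOL-Library.Extended_Real" "HOL-Library.Indicator_Function" "HOL-Computational_Algebra.Primes"
begin

text \<open>Finite fields are HOL-Algebra records, so that one can quantify over all of them inside a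
  formula; only the values on the plane \<open>carrier F \<times> carrier F\<close> of a function are relevant.\<close>

definition admissible_field :: "('a, 'm) ring_scheme \<Rightarrow> bool" where
  "admissible_field F \<longleftrightarrow>
     field F \<and> finite (carrier F) \<and>
     (\<exists>p k::nat. prime p \<and> odd p \<and> 0 < k \<and> card (carrier F) = p ^ k) \<and>
     (\<exists>s\<in>carrier F. s \<otimes>\<^bsub>F\<^esub> s = \<one>\<^bsub>F\<^esub> \<oplus>\<^bsub>F\<^esub> \<one>\<^bsub>F\<^esub> \<oplus>\<^bsub>F\<^esub> \<one>\<^bsub>F\<^esub>) \<and>
     \<one>\<^bsub>F\<^esub> \<oplus>\<^bsub>F\<^esub> \<one>\<^bsub>F\<^esub> \<oplus>\<^bsub>F\<^esub> \<one>\<^bsub>F\<^esub> \<noteq> \<zero>\<^bsub>F\<^esub>"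

definition plane :: "('a, 'm) ring_scheme \<Rightarrow> ('a \<times> 'a) set" where
  "plane F = carrier F \<times> carrier F"

definition plane_minus :: "('a, 'm) ring_scheme \<Rightarrow> 'a \<times> 'a \<Rightarrow> 'a \<times> 'a \<Rightarrow> 'a \<times> 'a" where
  "plane_minus F x y = (fst x \<ominus>\<^bsub>F\<^esub> fst y, snd x \<ominus>\<^bsub>F\<^esub> snd y)"

definition sq_norm :: "('a, 'm) ring_scheme \<Rightarrow> 'a \<times> 'a \<Rightarrow> 'a" where
  "sq_norm F x = (fst x \<otimes>\<^bsub>F\<^esub> fst x) \<oplus>\<^bsub>F\<^esub> (snd x \<otimes>\<^bsub>F\<^esub> snd x)"

definition circle :: "('a, 'm) ring_scheme \<Rightarrow> 'a \<Rightarrow> ('a \<times> 'a) set" where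
  "circle F t = {x \<in> plane F. sq_norm F x = t}"

text \<open>For \<open>1 \<le> p < \<infinity>\<close>, \<open>powr\<close> agrees with the usual power also at \<open>0\<close>, since \<open>0 powr p = 0\<close>.\<close>

definition Lp_norm :: "('a, 'm) ring_scheme \<Rightarrow> ereal \<Rightarrow> ('a \<times> 'a \<Rightarrow> real) \<Rightarrow> real" where
  "Lp_norm F p f =
     (if p = \<infinity> then Max ((\<lambda>x. \<bar>f x\<bar>) ` plane F)
      else (1 / real (card (carrier F)) ^ 2 * (\<Sum>x\<in>plane F. \<bar>f x\<bar> powr real_of_ereal p))
             powr (1 / real_of_ereal p))"

definition K3_form ::
    "('a, 'm) ring_scheme \<Rightarrow> 'a \<Rightarrow> ('a \<times> 'a \<Rightarrow> real) \<Rightarrow> ('a \<times> 'a \<Rightarrow> real) \<Rightarrow> ('a \<times> 'a \<Rightarrow> real) \<Rightarrow> real"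
  where
  "K3_form F t f\<^sub>1 f\<^sub>2 f\<^sub>3 =
     1 / (real (card (carrier F)) ^ 2 * real (card (circle F t))) *
     (\<Sum>x\<^sub>1\<in>plane F. \<Sum>x\<^sub>2\<in>plane F. \<Sum>x\<^sub>3\<in>plane F.
        indicator (circle F t) (plane_minus F x\<^sub>1 x\<^sub>2) *
        indicator (circle F t) (plane_minus F x\<^sub>2 x\<^sub>3) *
        indicator (circle F t) (plane_minus F x\<^sub>3 x\<^sub>1) *
        (f\<^sub>1 x\<^sub>1 * f\<^sub>2 x\<^sub>2 * f\<^sub>3 x\<^sub>3))"

definition K3_bound ::
    "('a, 'm) ring_scheme \<Rightarrow> 'a \<Rightarrow> ereal \<Rightarrow> ereal \<Rightarrow> ereal \<Rightarrow> real \<Rightarrow> bool" where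
  "K3_bound F t p\<^sub>1 p\<^sub>2 p\<^sub>3 C \<longleftrightarrow>
     (\<forall>f\<^sub>1 f\<^sub>2 f\<^sub>3. (\<forall>x\<in>plane F. 0 \<le> f\<^sub>1 x \<and> 0 \<le> f\<^sub>2 x \<and> 0 \<le> f\<^sub>3 x) \<longrightarrow>
        K3_form F t f\<^sub>1 f\<^sub>2 f\<^sub>3 \<le> C * (Lp_norm F p\<^sub>1 f\<^sub>1 * Lp_norm F p\<^sub>2 f\<^sub>2 * Lp_norm F p\<^sub>3 f\<^sub>3))"

text \<open>The least constant exists, see \<open>K3_const_least\<close> below.\<close>

definition K3_const ::
    "('a, 'm) ring_scheme \<Rightarrow> 'a \<Rightarrow> ereal \<Rightarrow> ereal \<Rightarrow> ereal \<Rightarrow> real" where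
  "K3_const F t p\<^sub>1 p\<^sub>2 p\<^sub>3 = (LEAST C. K3_bound F t p\<^sub>1 p\<^sub>2 p\<^sub>3 C)"

text \<open>Every finite field is isomorphic to one whose carrier is a set of natural numbers, so
  quantifying over \<open>nat ring\<close> covers all finite fields.\<close>

definition K3_strong :: "ereal \<Rightarrow> ereal \<Rightarrow> ereal \<Rightarrow> bool" where
  "K3_strong p\<^sub>1 p\<^sub>2 p\<^sub>3 \<longleftrightarrow>
     (\<exists>C\<ge>1. \<forall>F::nat ring. admissible_field F \<longrightarrow>
        (\<forall>t\<in>carrier F - {\<zero>\<^bsub>F\<^esub>}. K3_const F t p\<^sub>1 p\<^sub>2 p\<^sub>3 \<le> C))"

definition K3_restricted :: "ereal \<Rightarrow> ereal \<Rightarrow> ereal \<Rightarrow> bool" where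
  "K3_restricted p\<^sub>1 p\<^sub>2 p\<^sub>3 \<longleftrightarrow>
     (\<exists>C::real. \<forall>F::nat ring. admissible_field F \<longrightarrow>
        (\<forall>t\<in>carrier F - {\<zero>\<^bsub>F\<^esub>}. \<forall>E G H. E \<subseteq> plane F \<and> G \<subseteq> plane F \<and> H \<subseteq> plane F \<longrightarrow>
           K3_form F t (indicator E) (indicator G) (indicator H) \<le>
             C * (Lp_norm F p\<^sub>1 (indicator E) * Lp_norm F p\<^sub>2 (indicator G)
                  * Lp_norm F p\<^sub>3 (indicator H))))"

definition K3_region :: "ereal \<Rightarrow> ereal \<Rightarrow> ereal \<Rightarrow> bool" where
  "K3_region p\<^sub>1 p\<^sub>2 p\<^sub>3 \<longleftrightarrow>
     2 / p\<^sub>1 + 1 / p\<^sub>2 + 1 / p\<^sub>3 \<le> 2 \<and>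
     1 / p\<^sub>1 + 2 / p\<^sub>2 + 1 / p\<^sub>3 \<le> 2 \<and>
     1 / p\<^sub>1 + 1 / p\<^sub>2 + 2 / p\<^sub>3 \<le> 2"

lemma plane_finite_card:
  assumes "finite (carrier F)"
  shows "finite (plane F)" "card (plane F) = card (carrier F) ^ 2"
  using assms by (simp_all add: plane_def card_cartesian_product power2_eq_square)

lemma Lp_norm_nonneg:
  assumes "finite (carrier F)" "carrier F \<noteq> {}"
  shows "0 \<le> Lp_norm F p f"
proof (cases "p = \<infinity>")
  case True
  obtain x where x: "x \<in> plane F" using assms(2) by (auto simp: plane_def)
  have "\<bar>f x\<bar> \<le> Max ((\<lambda>x. \<bar>f x\<bar>) ` plane F)"
    using x assms(1) by (intro Max_ge) (auto simp: plane_finite_card)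
  with True show ?thesis by (simp add: Lp_norm_def)
qed (simp add: Lp_norm_def)

lemma Lp_norm_one:
  assumes "finite (carrier F)" "carrier F \<noteq> {}"
  shows "Lp_norm F p (\<lambda>_. 1) = 1"
proof -
  have "plane F \<noteq> {}" using assms(2) by (auto simp: plane_def)
  moreover have "real (card (carrier F)) \<noteq> 0" using assms by simp
  ultimately show ?thesis
    using assms(1) by (simp add: Lp_norm_def plane_finite_card)
qed

lemma abs_le_Lp_norm:
  assumes "finite (carrier F)" "1 \<le> p" "x \<in> plane F"
  shows "\<bar>f x\<bar> \<le> real (card (carrier F)) ^ 2 * Lp_norm F p f"
proof -
  define N where "N = real (card (carrier F)) ^ 2"
  have fin: "finite (plane F)" using assms(1) by (simp add: plane_finite_card)
  have ne: "carrier F \<noteq> {}" using assms(3) by (auto simp: plane_def)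
  have "1 \<le> card (carrier F)" using assms(1) ne by (simp add: Suc_leI card_gt_0_iff)
  hence N: "N \<ge> 1" unfolding N_def by simp
  show ?thesis
  proof (cases "p = \<infinity>")
    case True
    have "\<bar>f x\<bar> \<le> Lp_norm F p f"
      using True fin assms(3) by (auto simp: Lp_norm_def intro: Max_ge)
    also have "\<dots> \<le> N * Lp_norm F p f"
      using N Lp_norm_nonneg[OF assms(1) ne, of p f] by (simp add: mult_le_cancel_right1)
    finally show ?thesis by (simp add: N_def)
  next
    case False
    then obtain r where r: "p = ereal r" using assms(2) by (cases p) auto
    with assms(2) have r1: "r \<ge> 1" by simp
    define S where "S = (\<Sum>x\<in>plane F. \<bar>f x\<bar> powr r)"
    have S0: "0 \<le> S" unfolding S_def by (intro sum_nonneg) auto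
    have "\<bar>f x\<bar> powr r \<le> S"
      unfolding S_def using fin assms(3) by (intro member_le_sum) auto
    hence "(\<bar>f x\<bar> powr r) powr (1/r) \<le> S powr (1/r)"
      using r1 by (intro powr_mono2) auto
    hence "\<bar>f x\<bar> \<le> S powr (1/r)" using r1 by (simp add: powr_powr)
    also have "S = N * (1/N * S)" using N by simp
    also have "(N * (1/N * S)) powr (1/r) = N powr (1/r) * (1/N * S) powr (1/r)"
      by (rule powr_mult)
    also have "\<dots> \<le> N powr 1 * (1/N * S) powr (1/r)"
      using N r1 by (intro mult_right_mono powr_mono) auto
    also have "\<dots> = N * Lp_norm F p f" using N r by (simp add: Lp_norm_def N_def S_def)
    finally show ?thesis by (simp add: N_def)
  qed
qed

lemma K3_bound_exists:
  assumes "finite (carrier F)" "1 \<le> p\<^sub>1" "1 \<le> p\<^sub>2" "1 \<le> p\<^sub>3"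
  shows "\<exists>C. K3_bound F t p\<^sub>1 p\<^sub>2 p\<^sub>3 C"
proof -
  define N where "N = real (card (carrier F)) ^ 2"
  define K where "K = 1 / (real (card (carrier F)) ^ 2 * real (card (circle F t)))"
  have N0: "0 \<le> N" and K0: "0 \<le> K" by (auto simp: N_def K_def)
  let ?P = "plane F"
  have "K3_form F t f g h \<le>
      (K * (\<Sum>x\<in>?P. \<Sum>y\<in>?P. \<Sum>z\<in>?P. N * N * N))
        * (Lp_norm F p\<^sub>1 f * Lp_norm F p\<^sub>2 g * Lp_norm F p\<^sub>3 h)"
    if nn: "\<forall>x\<in>?P. 0 \<le> f x \<and> 0 \<le> g x \<and> 0 \<le> h x" for f g h
  proof -
    let ?M = "Lp_norm F p\<^sub>1 f * Lp_norm F p\<^sub>2 g * Lp_norm F p\<^sub>3 h"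
    let ?I = "\<lambda>x y z. indicator (circle F t) (plane_minus F x y) *
        indicator (circle F t) (plane_minus F y z) *
        indicator (circle F t) (plane_minus F z x) :: real"
    have le: "?I x y z * (f x * g y * h z) \<le> N * N * N * ?M"
      if "x \<in> ?P" "y \<in> ?P" "z \<in> ?P" for x y z
    proof -
      have ne: "carrier F \<noteq> {}" using that by (auto simp: plane_def)
      note M0 = Lp_norm_nonneg[OF assms(1) ne]
      have b: "f x \<le> N * Lp_norm F p\<^sub>1 f" "g y \<le> N * Lp_norm F p\<^sub>2 g" "h z \<le> N * Lp_norm F p\<^sub>3 h"
        using abs_le_Lp_norm[OF assms(1,2) that(1), of f]
          abs_le_Lp_norm[OF assms(1,3) that(2), of g]
          abs_le_Lp_norm[OF assms(1,4) that(3), of h] by (auto simp: N_def)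
      have p0: "0 \<le> f x * g y * h z" using nn that by simp
      have "?I x y z * (f x * g y * h z) \<le> 1 * (f x * g y * h z)"
        using p0 by (intro mult_right_mono) (auto simp: indicator_def)
      also have "f x * g y * h z \<le>
          (N * Lp_norm F p\<^sub>1 f) * (N * Lp_norm F p\<^sub>2 g) * (N * Lp_norm F p\<^sub>3 h)"
        using nn that b N0 M0 by (intro mult_mono mult_nonneg_nonneg) auto
      finally show ?thesis by (simp add: mult_ac)
    qed
    have "K3_form F t f g h \<le> K * (\<Sum>x\<in>?P. \<Sum>y\<in>?P. \<Sum>z\<in>?P. N * N * N * ?M)"
      unfolding K3_form_def K_def[symmetric]
      using K0 le by (intro mult_left_mono sum_mono) auto
    thus ?thesis by (simp add: sum_distrib_right mult_ac)
  qed
  thus ?thesis unfolding K3_bound_def by blast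
qed

theorem K3_const_least:
  assumes "finite (carrier F)" "carrier F \<noteq> {}" "1 \<le> p\<^sub>1" "1 \<le> p\<^sub>2" "1 \<le> p\<^sub>3"
  shows "K3_bound F t p\<^sub>1 p\<^sub>2 p\<^sub>3 (K3_const F t p\<^sub>1 p\<^sub>2 p\<^sub>3)"
    and "K3_bound F t p\<^sub>1 p\<^sub>2 p\<^sub>3 C \<Longrightarrow> K3_const F t p\<^sub>1 p\<^sub>2 p\<^sub>3 \<le> C"
proof -
  define B where "B = {C. K3_bound F t p\<^sub>1 p\<^sub>2 p\<^sub>3 C}"
  have ne: "B \<noteq> {}" using K3_bound_exists[OF assms(1,3,4,5)] by (auto simp: B_def)
  have "K3_form F t (\<lambda>_. 1) (\<lambda>_. 1) (\<lambda>_. 1) \<le> C" if "C \<in> B" for C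
  proof -
    have "K3_bound F t p\<^sub>1 p\<^sub>2 p\<^sub>3 C" using that by (simp add: B_def)
    from this[unfolded K3_bound_def, rule_format, of "\<lambda>_. 1" "\<lambda>_. 1" "\<lambda>_. 1"]
    show ?thesis by (simp add: Lp_norm_one[OF assms(1,2)])
  qed
  hence bdd: "bdd_below B" by (rule bdd_belowI)
  have inB: "K3_bound F t p\<^sub>1 p\<^sub>2 p\<^sub>3 (Inf B)"
    unfolding K3_bound_def
  proof (intro allI impI)
    fix f g h :: "'a \<times> 'a \<Rightarrow> real"
    assume nn: "\<forall>x\<in>plane F. 0 \<le> f x \<and> 0 \<le> g x \<and> 0 \<le> h x"
    let ?M = "Lp_norm F p\<^sub>1 f * Lp_norm F p\<^sub>2 g * Lp_norm F p\<^sub>3 h"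
    have M0: "0 \<le> ?M" using Lp_norm_nonneg[OF assms(1,2)] by simp
    have le: "K3_form F t f g h \<le> C * ?M" if "C \<in> B" for C
      using that nn unfolding B_def K3_bound_def by blast
    show "K3_form F t f g h \<le> Inf B * ?M"
    proof (cases "?M = 0")
      case True
      obtain C where "C \<in> B" using ne by blast
      from le[OF this] show ?thesis unfolding True by simp
    next
      case False
      with M0 have pos: "0 < ?M" by linarith
      have "K3_form F t f g h / ?M \<le> Inf B"
        using ne le pos by (intro cInf_greatest) (simp_all add: pos_divide_le_eq)
      thus ?thesis by (rule iffD1[OF pos_divide_le_eq[OF pos]])
    qed
  qed
  have low: "Inf B \<le> C" if "K3_bound F t p\<^sub>1 p\<^sub>2 p\<^sub>3 C" for C
    using that bdd by (intro cInf_lower) (auto simp: B_def)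
  have eq: "K3_const F t p\<^sub>1 p\<^sub>2 p\<^sub>3 = Inf B"
    unfolding K3_const_def using inB low by (rule Least_equality)
  show "K3_bound F t p\<^sub>1 p\<^sub>2 p\<^sub>3 (K3_const F t p\<^sub>1 p\<^sub>2 p\<^sub>3)" using inB by (simp add: eq)
  show "K3_bound F t p\<^sub>1 p\<^sub>2 p\<^sub>3 C \<Longrightarrow> K3_const F t p\<^sub>1 p\<^sub>2 p\<^sub>3 \<le> C" using low by (simp add: eq)
qed

end

theory Submission
  imports Defs "HOL-Algebra.Multiplicative_Group" "HOL-Number_Theory.Cong"
begin

text \<open>Two distinct circles of the same nonzero radius meet in at most two points, and a circle has
  between \<open>q - 2\<close> and \<open>2 * q\<close> points; sufficiency uses nothing else about the field. Normalise
  \<open>f i = norm (f i) * F i powr (1 / p i)\<close> with \<open>F i\<close> of mean at most 1. The exponent vectors in the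
  region are convex combinations of \<open>(0,0,0)\<close>, \<open>(1,0,0)\<close>, \<open>(2/3,2/3,0)\<close>, \<open>(1/2,1/2,1/2)\<close> and
  their permutations, so the integrand is pointwise at most the sum of the integrands at these
  vertices and only the vertices need to be estimated: no interpolation theorem is needed. The
  vertex \<open>(2/3,2/3,0)\<close> is the \<open>L^(3/2) \<rightarrow> L^3\<close> bound for circular averages, proved by expanding the cube.
  At \<open>(1/2,1/2,1/2)\<close>, expanding the square of the sum over the triangles at a vertex and applying
  Cauchy-Schwarz to pairs of triangles yields the strong bound, not just the restricted one.
  Necessity follows from testing with a point and twice the circle around it, in prime fields
  of arbitrarily large order.\<close>

section \<open>Triangles in graphs with few common neighbours\<close>

text \<open>The normalisation fixes the scale: a circle has about q points, so for densities of mean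
  at most 1 the weighted number of triangles has to be O(q^3). With weight on one vertex, counting
  by degrees suffices. With weight on two or three vertices a density may concentrate on few points,
  and the gain has to come from circles meeting in at most two points. That gain exists only for
  distinct centres, so the expanded powers are split into distinct and coincident indices, and each
  auxiliary inequality carries the power of q that balances the two parts. Convexity can be used
  pointwise because one density per function serves all vertices: only the power to which it is
  raised changes. For necessity q must be unbounded, since a power of q is compared with a constant;
  the square root of 3 then provides the triangles on which the test functions live.\<close>

text \<open>The exponents are \<open>\<alpha> - \<beta>\<close> times \<open>(1,0,0)\<close> plus \<open>3/2 * (\<beta> - \<gamma>)\<close> times \<open>(2/3,2/3,0)\<close> plus
  \<open>2 * \<gamma>\<close> times \<open>(1/2,1/2,1/2)\<close>, and these weights add up to at most 1.\<close>

lemma powr_le_vertices_ordered: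
  fixes x y z \<alpha> \<beta> \<gamma> :: real
  assumes "0 \<le> x" "0 \<le> y" "0 \<le> z" and "\<beta> \<le> \<alpha>" "\<gamma> \<le> \<beta>" "0 \<le> \<gamma>" and "2 * \<alpha> + \<beta> + \<gamma> \<le> 2"
  shows "x powr \<alpha> * y powr \<beta> * z powr \<gamma>
    \<le> 1 + x + (x powr (1/3))\<^sup>2 * (y powr (1/3))\<^sup>2 + sqrt x * sqrt y * sqrt z"
    (is "?l \<le> ?M")
\<comment> \<open>Since \<open>0 powr e = 0\<close> even for e = 0, the left side vanishes as soon
  as one base does.\<close>
proof (cases "x = 0 \<or> y = 0 \<or> z = 0")
  case False
  hence pos: "0 < x" "0 < y" "0 < z" using assms by auto
  let ?Y = "x powr (2/3) * y powr (2/3)" and ?Z = "x powr (1/2) * y powr (1/2) * z powr (1/2)"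
  have cube_root: "(c powr (1/3))\<^sup>2 = c powr (2/3)" if "0 < c" for c :: real
    using that by (simp add: power2_eq_square flip: powr_add)
  have M: "?M = 1 + x + ?Y + ?Z"
    using pos by (simp add: cube_root powr_half_sqrt)
  have XYZ: "0 < ?Y" "0 < ?Z" using pos by auto
  hence M1: "1 \<le> ?M" "x \<le> ?M" "?Y \<le> ?M" "?Z \<le> ?M"
    unfolding M using pos by linarith+
  have "?Y powr (3/2 * (\<beta> - \<gamma>)) = x powr (\<beta> - \<gamma>) * y powr (\<beta> - \<gamma>)"
    "?Z powr (2 * \<gamma>) = x powr \<gamma> * y powr \<gamma> * z powr \<gamma>"
    by (simp_all add: powr_mult powr_powr diff_divide_distrib)
  hence "x powr (\<alpha> - \<beta>) * ?Y powr (3/2 * (\<beta> - \<gamma>)) * ?Z powr (2 * \<gamma>) =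
      (x powr (\<alpha> - \<beta>) * x powr (\<beta> - \<gamma>) * x powr \<gamma>) * (y powr (\<beta> - \<gamma>) * y powr \<gamma>) * z powr \<gamma>"
    by simp
  also have "\<dots> = ?l"
    by (simp flip: powr_add)
  finally have "?l = x powr (\<alpha> - \<beta>) * ?Y powr (3/2 * (\<beta> - \<gamma>)) * ?Z powr (2 * \<gamma>)" ..
  also have "\<dots> \<le> ?M powr (\<alpha> - \<beta>) * ?M powr (3/2 * (\<beta> - \<gamma>)) * ?M powr (2 * \<gamma>)"
    using pos XYZ M1 assms by (intro mult_mono powr_mono2 mult_nonneg_nonneg) auto
  also have "\<dots> = ?M powr ((\<alpha> - \<beta>) + 3/2 * (\<beta> - \<gamma>) + 2 * \<gamma>)"
    by (simp add: powr_add)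
  \<comment> \<open>The exponent is \<alpha> + \<beta>/2 + \<gamma>/2, half the left side of the
    last hypothesis. The summand 1 of \<open>?M\<close>, the vertex (0,0,0), absorbs the weight
    missing from 1.\<close>
  also have "\<dots> \<le> ?M powr 1"
    using M1 assms by (intro powr_mono) (auto simp: field_simps)
  finally show ?thesis using M1 by simp
next
  case True
  thus ?thesis using assms by auto
qed

text \<open>The right side is symmetric, so the exponents may be sorted; the inequality that doubles
  the largest exponent is the hypothesis of the sorted case.\<close>

lemma powr_le_vertices:
  fixes x y z \<alpha> \<beta> \<gamma> :: real
  assumes "0 \<le> x" "0 \<le> y" "0 \<le> z" and "0 \<le> \<alpha>" "0 \<le> \<beta>" "0 \<le> \<gamma>"
    and "2 * \<alpha> + \<beta> + \<gamma> \<le> 2" "\<alpha> + 2 * \<beta> + \<gamma> \<le> 2" "\<alpha> + \<beta> + 2 * \<gamma> \<le> 2"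
  shows "x powr \<alpha> * y powr \<beta> * z powr \<gamma> \<le> 1 + (x + y + z) +
    ((x powr (1/3))\<^sup>2 * (y powr (1/3))\<^sup>2 + (y powr (1/3))\<^sup>2 * (z powr (1/3))\<^sup>2 +
     (z powr (1/3))\<^sup>2 * (x powr (1/3))\<^sup>2) + sqrt x * sqrt y * sqrt z"
proof -
  have nn: "0 \<le> (c powr (1/3))\<^sup>2 * (d powr (1/3))\<^sup>2" for c d :: real by simp
  note nn' = nn[of x y] nn[of y z] nn[of z x] assms(1-3)
  consider "\<beta> \<le> \<alpha>" "\<gamma> \<le> \<beta>" | "\<gamma> \<le> \<alpha>" "\<beta> \<le> \<gamma>" | "\<alpha> \<le> \<beta>" "\<gamma> \<le> \<alpha>" | "\<gamma> \<le> \<beta>" "\<alpha> \<le> \<gamma>"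
    | "\<alpha> \<le> \<gamma>" "\<beta> \<le> \<alpha>" | "\<beta> \<le> \<gamma>" "\<alpha> \<le> \<beta>" by linarith
  thus ?thesis
  proof cases
    \<comment> \<open>\<open>of\<close> follows the order of first occurrence, and the assumption
      \<open>\<beta> \<le> \<alpha>\<close> puts \<beta> first: every case lists the middle, the
      largest and the smallest exponent.\<close>
    case 1 with powr_le_vertices_ordered[of x y z \<beta> \<alpha> \<gamma>] assms nn' show ?thesis
      by (simp only: mult_ac add_ac) linarith
  next
    case 2 with powr_le_vertices_ordered[of x z y \<gamma> \<alpha> \<beta>] assms nn' show ?thesis
      by (simp only: mult_ac add_ac) linarith
  next
    case 3 with powr_le_vertices_ordered[of y x z \<alpha> \<beta> \<gamma>] assms nn' show ?thesis
      by (simp only: mult_ac add_ac) linarith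
  next
    case 4 with powr_le_vertices_ordered[of y z x \<gamma> \<beta> \<alpha>] assms nn' show ?thesis
      by (simp only: mult_ac add_ac) linarith
  next
    case 5 with powr_le_vertices_ordered[of z x y \<alpha> \<gamma> \<beta>] assms nn' show ?thesis
      by (simp only: mult_ac add_ac) linarith
  next
    case 6 with powr_le_vertices_ordered[of z y x \<beta> \<gamma> \<alpha>] assms nn' show ?thesis
      by (simp only: mult_ac add_ac) linarith
  qed
qed

section \<open>Weighted triangle counts\<close>

text \<open>\<open>a\<close> is the adjacency matrix of the graph joining points at distance t, and
  q is the order of the field. The graph has order q^2, degrees O(q) and codegrees O(1).\<close>

locale triangle_kernel =
  fixes P :: "'v set" and a :: "'v \<Rightarrow> 'v \<Rightarrow> real" and q :: real
  assumes finite_P: "finite P"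
    and q_ge_1: "1 \<le> q"
    and card_P: "real (card P) \<le> q\<^sup>2"
    and zero_or_one: "a x y = 0 \<or> a x y = 1"
    and sym: "a x y = a y x"
    and irrefl: "a x x = 0"
    and degree: "(\<Sum>y\<in>P. a x y) \<le> 2 * q"
    and codegree: "y \<noteq> y' \<Longrightarrow> (\<Sum>x\<in>P. a x y * a x y') \<le> 2"
begin

definition w :: "'v \<Rightarrow> 'v \<Rightarrow> 'v \<Rightarrow> real" where
  "w x y z = a x y * a y z * a z x"

lemma a_nonneg: "0 \<le> a x y"
  using zero_or_one[of x y] by auto

lemma a_idem: "a x y * a x y = a x y"
  using zero_or_one[of x y] by auto

lemma w_nonneg: "0 \<le> w x y z"
  by (simp add: w_def a_nonneg)

lemma w_rotate: "w x y z = w y z x"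
  by (simp add: w_def)

lemma w_swap: "w x y z = w x z y"
  using sym[of x y] sym[of y z] sym[of z x] by (simp add: w_def)

lemma degree': "(\<Sum>y\<in>P. a y x) \<le> 2 * q"
  using degree[of x] by (simp add: sym[of x])

text \<open>The third vertex of a triangle is a common neighbour of the ends of the opposite edge.
  Irreflexivity disposes of equal ends, to which the codegree bound does not apply.\<close>

lemma sum_w: "(\<Sum>z\<in>P. w x y z) \<le> 2 * a x y"
proof (cases "x = y")
  case False
  have "(\<Sum>z\<in>P. w x y z) = a x y * (\<Sum>z\<in>P. a z x * a z y)"
    by (simp add: w_def sum_distrib_left sym[of y] mult_ac)
  also have "\<dots> \<le> a x y * 2"
    using False by (intro mult_left_mono codegree a_nonneg)
  finally show ?thesis by simp
qed (simp add: w_def irrefl)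

lemma sum_w_first: "(\<Sum>x\<in>P. w x y z) \<le> 2 * a y z"
  using sum_w[of y z] unfolding w_rotate[of _ y z] .

text \<open>Cyclic invariance of \<open>w\<close>; it carries estimates with weight on the first
  vertices over to the other positions.\<close>

lemma sum_w_rotate:
  "(\<Sum>x\<in>P. \<Sum>y\<in>P. \<Sum>z\<in>P. w x y z * \<phi> x y z) = (\<Sum>x\<in>P. \<Sum>y\<in>P. \<Sum>z\<in>P. w x y z * \<phi> z x y)"
  (is "?L = ?R")
proof -
  have "?R = (\<Sum>x\<in>P. \<Sum>y\<in>P. \<Sum>z\<in>P. w z x y * \<phi> z x y)"
    by (simp add: w_rotate)
  also have "\<dots> = (\<Sum>x\<in>P. \<Sum>z\<in>P. \<Sum>y\<in>P. w z x y * \<phi> z x y)"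
    by (intro sum.cong refl sum.swap)
  also have "\<dots> = ?L"
    by (rule sum.swap)
  finally show ?thesis by simp
qed

lemma triangles_pair:
  assumes "\<And>x y. 0 \<le> \<phi> x y"
  shows "(\<Sum>x\<in>P. \<Sum>y\<in>P. \<Sum>z\<in>P. w x y z * \<phi> x y) \<le> 2 * (\<Sum>x\<in>P. \<Sum>y\<in>P. a x y * \<phi> x y)"
proof -
  have "(\<Sum>x\<in>P. \<Sum>y\<in>P. \<Sum>z\<in>P. w x y z * \<phi> x y) = (\<Sum>x\<in>P. \<Sum>y\<in>P. (\<Sum>z\<in>P. w x y z) * \<phi> x y)"
    by (simp add: sum_distrib_right)
  also have "\<dots> \<le> (\<Sum>x\<in>P. \<Sum>y\<in>P. 2 * a x y * \<phi> x y)"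
    by (intro sum_mono mult_right_mono sum_w assms)
  finally show ?thesis by (simp add: sum_distrib_left mult_ac)
qed

text \<open>A vertex has at most 2q edges, each in at most two triangles. This is the exponent
  vector (1,0,0), and (0,0,0) for constant weight.\<close>

lemma triangles_vertex:
  assumes "\<And>x. 0 \<le> F x" and "sum F P \<le> q\<^sup>2"
  shows "(\<Sum>x\<in>P. \<Sum>y\<in>P. \<Sum>z\<in>P. w x y z * F x) \<le> 4 * q ^ 3"
proof -
  have "(\<Sum>x\<in>P. \<Sum>y\<in>P. \<Sum>z\<in>P. w x y z * F x) \<le> 2 * (\<Sum>x\<in>P. \<Sum>y\<in>P. a x y * F x)"
    using triangles_pair[of "\<lambda>x y. F x"] assms by simp
  also have "\<dots> = 2 * (\<Sum>x\<in>P. (\<Sum>y\<in>P. a x y) * F x)"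
    by (simp add: sum_distrib_right)
  also have "\<dots> \<le> 2 * (\<Sum>x\<in>P. (2 * q) * F x)"
    by (intro mult_left_mono sum_mono mult_right_mono degree assms) auto
  also have "\<dots> = 4 * q * sum F P"
    by (simp only: sum_distrib_left) (simp add: mult_ac)
  also have "\<dots> \<le> 4 * q * q\<^sup>2"
    using q_ge_1 assms by (intro mult_left_mono) auto
  finally show ?thesis by (simp add: power2_eq_square power3_eq_cube)
qed

lemma triangles_count: "(\<Sum>x\<in>P. \<Sum>y\<in>P. \<Sum>z\<in>P. w x y z) \<le> 4 * q ^ 3"
  using triangles_vertex[of "\<lambda>_. 1"] card_P by simp

text \<open>Summing over the centre x first leaves the codegree of two distinct ends. This is the
  basic gain behind both of the harder exponent vectors.\<close>

lemma sum_cherries: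
  assumes "\<And>y. 0 \<le> G y" and "sum G P \<le> q\<^sup>2"
  shows "(\<Sum>x\<in>P. \<Sum>y\<in>P. \<Sum>y'\<in>P. a x y * a x y' * (of_bool (y \<noteq> y') * (G y * G y'))) \<le> 2 * q ^ 4"
proof -
  have S0: "0 \<le> sum G P" using assms by (intro sum_nonneg) auto
  have "(\<Sum>x\<in>P. \<Sum>y\<in>P. \<Sum>y'\<in>P. a x y * a x y' * (of_bool (y \<noteq> y') * (G y * G y')))
      = (\<Sum>y\<in>P. \<Sum>x\<in>P. \<Sum>y'\<in>P. a x y * a x y' * (of_bool (y \<noteq> y') * (G y * G y')))"
    by (rule sum.swap)
  also have "\<dots> = (\<Sum>y\<in>P. \<Sum>y'\<in>P. \<Sum>x\<in>P. a x y * a x y' * (of_bool (y \<noteq> y') * (G y * G y')))"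
    by (intro sum.cong refl sum.swap)
  also have "\<dots> = (\<Sum>y\<in>P. \<Sum>y'\<in>P. (\<Sum>x\<in>P. a x y * a x y') * (of_bool (y \<noteq> y') * (G y * G y')))"
    by (simp add: sum_distrib_right)
  also have "\<dots> \<le> (\<Sum>y\<in>P. \<Sum>y'\<in>P. 2 * (G y * G y'))"
    by (intro sum_mono) (auto simp: assms(1) intro!: mult_right_mono codegree)
  also have "\<dots> = 2 * (sum G P * sum G P)"
    by (simp only: sum_product) (simp only: sum_distrib_left)
  also have "\<dots> \<le> 2 * (q\<^sup>2 * q\<^sup>2)"
    using assms S0 by (intro mult_left_mono mult_mono) auto
  finally show ?thesis by (simp add: power2_eq_square power4_eq_xxxx)
qed

lemma sum_of_bool: "i \<in> P \<Longrightarrow> (\<Sum>j\<in>P. of_bool (i = j) * f j) = (f i :: real)"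
  by (simp add: of_bool_def if_distribR finite_P if_distrib[of "\<lambda>c. c * _"] cong: if_cong)

lemma sum_of_bool': "i \<in> P \<Longrightarrow> (\<Sum>j\<in>P. of_bool (j = i) * f j) = (f i :: real)"
  using sum_of_bool[of i f] by (simp only: eq_commute)

section \<open>Weights on two vertices: exponents (2/3, 2/3, 0)\<close>

lemma mult_le_cubes:
  fixes X Y Z :: real
  assumes "0 \<le> X" "0 \<le> Y" "0 \<le> Z"
  shows "X * Y * Z \<le> X ^ 3 + Y ^ 3 + Z ^ 3"
proof -
  define M where "M = max X (max Y Z)"
  have "X * Y * Z \<le> M * M * M"
    using assms by (intro mult_mono) (auto simp: M_def)
  also have "\<dots> = M ^ 3" by (simp add: power3_eq_cube)
  also have "\<dots> \<le> X ^ 3 + Y ^ 3 + Z ^ 3"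
    using assms by (auto simp: M_def max_def)
  finally show ?thesis .
qed

text \<open>Young's inequality, with the two terms on the right equal at X = q Y. This is the
  natural ratio when X is a sum over about q neighbours of quantities of the size of Y.\<close>

lemma weighted_square_le_cubes:
  fixes X Y :: real
  assumes "0 \<le> X" "0 \<le> Y"
  shows "X * Y\<^sup>2 \<le> X ^ 3 / q\<^sup>2 + q * Y ^ 3"
proof (cases "X \<le> q * Y")
  case True
  have "X * Y\<^sup>2 \<le> q * Y * Y\<^sup>2" using True by (intro mult_right_mono) auto
  also have "\<dots> = q * Y ^ 3" by (simp add: power2_eq_square power3_eq_cube)
  moreover have "0 \<le> X ^ 3 / q\<^sup>2" using assms by simp
  ultimately show ?thesis by linarith
next
  case False
  have "Y \<le> X / q" using False q_ge_1 by (simp add: field_simps)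
  hence "X * Y\<^sup>2 \<le> X * (X / q)\<^sup>2" using assms by (intro mult_left_mono power_mono) auto
  also have "\<dots> = X ^ 3 / q\<^sup>2" by (simp add: power2_eq_square power3_eq_cube)
  moreover have "0 \<le> q * Y ^ 3" using assms q_ge_1 by simp
  ultimately show ?thesis by linarith
qed

text \<open>Two distinct neighbours of \<open>x\<close> have few further common neighbours, which controls the triples
  of distinct \<open>y\<close> in the expanded cube; in the other triples the coincidence removes one summation.\<close>

lemma edge_cubes:
  assumes v: "\<And>y. 0 \<le> v y" and sv: "(\<Sum>y\<in>P. v y ^ 3) \<le> q\<^sup>2"
  shows "(\<Sum>x\<in>P. (\<Sum>y\<in>P. a x y * (v y)\<^sup>2) ^ 3) \<le> 36 * q ^ 5"
proof -
  define p where "p y y' = (of_bool (y \<noteq> y') * (v y ^ 3 * v y' ^ 3) :: real)" for y y'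
  \<comment> \<open>The powers of q are chosen so that every part contributes O(q^5): summing
    \<open>v y ^ 6 / q\<close> over y' costs a degree 2q, which cancels the denominator, and
    \<open>p\<close> sums to O(q^4) over cherries.\<close>
  define e where "e y y' = v y ^ 6 / q + q * p y y' + of_bool (y = y') * v y ^ 6" for y y'
  define K where "K = (\<lambda>x. \<Sum>y\<in>P. \<Sum>y'\<in>P. a x y * a x y' * p y y')"
  define E where "E = (\<lambda>x. \<Sum>y\<in>P. \<Sum>y'\<in>P. a x y * a x y' * e y y')"
  have q0: "0 < q" using q_ge_1 by simp
  have p0: "0 \<le> p y y'" for y y' using v by (simp add: p_def)
  have e0: "0 \<le> e y y'" for y y' using v p0 q0 by (simp add: e_def)
  have K0: "0 \<le> K x" for x unfolding K_def by (intro sum_nonneg mult_nonneg_nonneg a_nonneg p0)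
  \<comment> \<open>For y \<noteq> y', Young's inequality with X = \<open>(v y)\<^sup>2\<close> and
    Y = \<open>v y * v y'\<close> turns Y^3 into the cherry weight \<open>p\<close>; the denominator
    q^2 may be weakened to q.\<close>
  have coincide: "v y ^ 4 * (v y')\<^sup>2 \<le> e y y'" for y y'
  proof (cases "y = y'")
    case True
    have "v y ^ 4 * (v y')\<^sup>2 = v y ^ 6" using True by (simp flip: power_add)
    moreover have "0 \<le> v y ^ 6 / q" using v q0 by simp
    ultimately show ?thesis using True by (simp add: e_def p_def)
  next
    case False
    have "(v y)\<^sup>2 * (v y * v y')\<^sup>2 \<le> ((v y)\<^sup>2) ^ 3 / q\<^sup>2 + q * (v y * v y') ^ 3"
      using v by (intro weighted_square_le_cubes) auto
    moreover have "(v y)\<^sup>2 * (v y * v y')\<^sup>2 = v y ^ 4 * (v y')\<^sup>2"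
      by (simp add: power_mult_distrib flip: power_add mult.assoc)
    moreover have "((v y)\<^sup>2) ^ 3 / q\<^sup>2 \<le> v y ^ 6 / q"
      using q_ge_1 v by (simp flip: power_mult) (intro divide_left_mono, auto simp: power2_eq_square)
    ultimately show ?thesis using False by (simp add: e_def p_def power_mult_distrib)
  qed
  have p_sym: "p x y = p y x" for x y by (auto simp: p_def)
  have n0: "0 \<le> of_bool b * e x y" for b x y using e0 by simp
  have pointwise: "(v i)\<^sup>2 * (v j)\<^sup>2 * (v k)\<^sup>2 \<le>
      (p i j + p j k + p k i) + (of_bool (i = j) * e i k + of_bool (j = k) * e j i + of_bool (k = i) * e k j)"
    (is "?l \<le> ?r") for i j k
  proof -
    have square: "c\<^sup>2 * c\<^sup>2 = c ^ 4" for c :: real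
      by (simp flip: power_add)
    consider "i = j" | "j = k" | "k = i" | "i \<noteq> j" "j \<noteq> k" "k \<noteq> i" by blast
    thus ?thesis
    proof cases
      case 1
      have "?l \<le> e i k" using coincide[of i k] 1 by (simp add: square)
      moreover have "of_bool (i = j) * e i k = e i k" using 1 by simp
      ultimately show ?thesis
        using p0[of i j] p0[of j k] p0[of k i] n0[of "j = k" j i] n0[of "k = i" k j] by linarith
    next
      case 2
      have "?l = (v j)\<^sup>2 * (v j)\<^sup>2 * (v i)\<^sup>2" using 2 by (simp only: mult_ac)
      hence "?l \<le> e j i" using coincide[of j i] by (simp only: square)
      moreover have "of_bool (j = k) * e j i = e j i" using 2 by simp
      ultimately show ?thesis
        using p0[of i j] p0[of j k] p0[of k i] n0[of "i = j" i k] n0[of "k = i" k j] by linarith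
    next
      case 3
      have "?l = (v k)\<^sup>2 * (v k)\<^sup>2 * (v j)\<^sup>2" using 3 by (simp only: mult_ac)
      hence "?l \<le> e k j" using coincide[of k j] by (simp only: square)
      moreover have "of_bool (k = i) * e k j = e k j" using 3 by simp
      ultimately show ?thesis
        using p0[of i j] p0[of j k] p0[of k i] n0[of "i = j" i k] n0[of "j = k" j i] by linarith
    next
      case 4
      \<comment> \<open>Regrouped into products over the three pairs, each cube is the weight of a
        cherry with distinct ends.\<close>
      have "?l = (v i * v j) * (v j * v k) * (v k * v i)"
        by (simp add: power2_eq_square)
      also have "\<dots> \<le> (v i * v j) ^ 3 + (v j * v k) ^ 3 + (v k * v i) ^ 3"
        using v by (intro mult_le_cubes) auto
      also have "\<dots> = p i j + p j k + p k i"
        using 4 by (simp add: p_def power_mult_distrib)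
      finally show ?thesis using 4 by simp
    qed
  qed
  have cube: "(\<Sum>y\<in>P. a x y * (v y)\<^sup>2) ^ 3 \<le> 6 * q * K x + 3 * E x" for x
  proof -
    have "(\<Sum>y\<in>P. a x y * (v y)\<^sup>2) ^ 3 =
        (\<Sum>i\<in>P. \<Sum>j\<in>P. \<Sum>k\<in>P. a x i * a x j * a x k * ((v i)\<^sup>2 * (v j)\<^sup>2 * (v k)\<^sup>2))"
      by (simp add: power3_eq_cube sum_product sum_distrib_left sum_distrib_right mult_ac)
    also have "\<dots> \<le> (\<Sum>i\<in>P. \<Sum>j\<in>P. \<Sum>k\<in>P. a x i * a x j * a x k * ((p i j + p j k + p k i) +
        (of_bool (i = j) * e i k + of_bool (j = k) * e j i + of_bool (k = i) * e k j)))"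
      by (intro sum_mono mult_left_mono pointwise mult_nonneg_nonneg a_nonneg)
    also have "\<dots> = (\<Sum>i\<in>P. \<Sum>j\<in>P. \<Sum>k\<in>P. (a x i * a x j * a x k * p i j +
        a x i * a x j * a x k * p j k + a x i * a x j * a x k * p k i) +
        (of_bool (i = j) * (a x i * a x j * a x k * e i k) +
         of_bool (j = k) * (a x i * a x j * a x k * e j i) +
         of_bool (k = i) * (a x i * a x j * a x k * e k j)))"
      by (intro sum.cong refl) (simp only: algebra_simps)
    also have "\<dots> = (\<Sum>i\<in>P. \<Sum>j\<in>P. \<Sum>k\<in>P. a x i * a x j * a x k * p i j) +
        (\<Sum>i\<in>P. \<Sum>j\<in>P. \<Sum>k\<in>P. a x i * a x j * a x k * p j k) +
        (\<Sum>i\<in>P. \<Sum>j\<in>P. \<Sum>k\<in>P. a x i * a x j * a x k * p k i) +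
        ((\<Sum>i\<in>P. \<Sum>j\<in>P. \<Sum>k\<in>P. of_bool (i = j) * (a x i * a x j * a x k * e i k)) +
         (\<Sum>i\<in>P. \<Sum>j\<in>P. \<Sum>k\<in>P. of_bool (j = k) * (a x i * a x j * a x k * e j i)) +
         (\<Sum>i\<in>P. \<Sum>j\<in>P. \<Sum>k\<in>P. of_bool (k = i) * (a x i * a x j * a x k * e k j)))"
      by (simp only: sum.distrib)
    also have "(\<Sum>i\<in>P. \<Sum>j\<in>P. \<Sum>k\<in>P. a x i * a x j * a x k * p i j) = (\<Sum>k\<in>P. a x k) * K x"
      unfolding K_def mult.commute[of "sum (a x) P"] by (simp add: sum_distrib_left sum_distrib_right mult_ac)
    also have "(\<Sum>i\<in>P. \<Sum>j\<in>P. \<Sum>k\<in>P. a x i * a x j * a x k * p j k) = (\<Sum>k\<in>P. a x k) * K x"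
      unfolding K_def sum_distrib_right[of "a x"] by (simp add: sum_distrib_left mult.assoc)
    also have "(\<Sum>i\<in>P. \<Sum>j\<in>P. \<Sum>k\<in>P. a x i * a x j * a x k * p k i) =
        (\<Sum>j\<in>P. \<Sum>i\<in>P. \<Sum>k\<in>P. a x j * (a x i * a x k * p i k))"
      by (subst sum.swap, intro sum.cong refl) (simp only: p_sym mult_ac)
    also have "\<dots> = (\<Sum>k\<in>P. a x k) * K x"
      unfolding K_def sum_distrib_right[of "a x"] by (simp add: sum_distrib_left)
    also have "(\<Sum>i\<in>P. \<Sum>j\<in>P. \<Sum>k\<in>P. of_bool (i = j) * (a x i * a x j * a x k * e i k)) =
        (\<Sum>i\<in>P. \<Sum>k\<in>P. \<Sum>j\<in>P. of_bool (i = j) * (a x i * a x j * a x k * e i k))"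
      by (intro sum.cong refl sum.swap)
    also have "\<dots> = E x"
      unfolding E_def by (intro sum.cong refl) (simp add: sum_of_bool a_idem)
    also have "(\<Sum>i\<in>P. \<Sum>j\<in>P. \<Sum>k\<in>P. of_bool (j = k) * (a x i * a x j * a x k * e j i)) =
        (\<Sum>i\<in>P. \<Sum>j\<in>P. (a x j * a x j) * (a x i * e j i))"
      by (intro sum.cong refl) (subst sum_of_bool, assumption, simp only: mult_ac)
    also have "\<dots> = E x"
      unfolding E_def by (subst sum.swap) (simp add: a_idem mult.assoc)
    also have "(\<Sum>i\<in>P. \<Sum>j\<in>P. \<Sum>k\<in>P. of_bool (k = i) * (a x i * a x j * a x k * e k j)) =
        (\<Sum>i\<in>P. \<Sum>j\<in>P. (a x i * a x i) * (a x j * e i j))"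
      by (intro sum.cong refl) (subst sum_of_bool', assumption, simp only: mult_ac)
    also have "\<dots> = E x"
      unfolding E_def by (simp add: a_idem mult.assoc)
    \<comment> \<open>In each of the three terms with \<open>p\<close> one neighbour remains free
      and costs the degree 2q.\<close>
    also have "(\<Sum>k\<in>P. a x k) * K x + (\<Sum>k\<in>P. a x k) * K x + (\<Sum>k\<in>P. a x k) * K x + (E x + E x + E x)
        \<le> 6 * q * K x + 3 * E x"
      using mult_right_mono[OF degree K0, of x x] by linarith
    finally show ?thesis .
  qed
  have sum_K: "(\<Sum>x\<in>P. K x) \<le> 2 * q ^ 4"
    using sum_cherries[of "\<lambda>y. v y ^ 3"] v sv by (simp add: K_def p_def)
  have six: "(\<Sum>x\<in>P. \<Sum>y\<in>P. a x y * v y ^ 6) \<le> 2 * q ^ 5"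
  proof -
    have "(\<Sum>x\<in>P. \<Sum>y\<in>P. a x y * v y ^ 6) = (\<Sum>y\<in>P. (\<Sum>x\<in>P. a x y) * v y ^ 6)"
      by (subst sum.swap) (simp add: sum_distrib_right)
    also have "\<dots> \<le> (\<Sum>y\<in>P. 2 * q * v y ^ 6)"
      using v by (intro sum_mono mult_right_mono degree') auto
    also have "\<dots> = 2 * q * (\<Sum>y\<in>P. v y ^ 3 * v y ^ 3)"
      by (simp add: sum_distrib_left flip: power_add)
    \<comment> \<open>One factor \<open>v y ^ 3\<close> is bounded by the total: a sum of squares is
      at most the square of the sum.\<close>
    also have "\<dots> \<le> 2 * q * (\<Sum>y\<in>P. v y ^ 3 * (\<Sum>y\<in>P. v y ^ 3))"
      using q0 v finite_P by (intro mult_left_mono sum_mono member_le_sum) auto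
    also have "\<dots> = 2 * q * ((\<Sum>y\<in>P. v y ^ 3) * (\<Sum>y\<in>P. v y ^ 3))"
      by (simp only: sum_distrib_right)
    also have "\<dots> \<le> 2 * q * (q\<^sup>2 * q\<^sup>2)"
      using q0 v by (intro mult_left_mono mult_mono sv sum_nonneg) auto
    finally show ?thesis by (simp add: eval_nat_numeral)
  qed
  have sum_E: "(\<Sum>x\<in>P. E x) \<le> 8 * q ^ 5"
  proof -
    have "E x \<le> 2 * (\<Sum>y\<in>P. a x y * v y ^ 6) + q * K x + (\<Sum>y\<in>P. a x y * v y ^ 6)" for x
    proof -
      have "E x = (\<Sum>y\<in>P. \<Sum>y'\<in>P. a x y * v y ^ 6 / q * a x y' + q * (a x y * a x y' * p y y') +
          of_bool (y = y') * (a x y * a x y' * v y ^ 6))"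
        unfolding E_def e_def by (intro sum.cong refl) (simp add: algebra_simps)
      also have "\<dots> = (\<Sum>y\<in>P. \<Sum>y'\<in>P. a x y * v y ^ 6 / q * a x y') + q * K x +
          (\<Sum>y\<in>P. \<Sum>y'\<in>P. of_bool (y = y') * (a x y * a x y' * v y ^ 6))"
        by (simp only: sum.distrib K_def sum_distrib_left)
      also have "(\<Sum>y\<in>P. \<Sum>y'\<in>P. of_bool (y = y') * (a x y * a x y' * v y ^ 6)) = (\<Sum>y\<in>P. a x y * v y ^ 6)"
        by (intro sum.cong refl) (simp add: sum_of_bool a_idem)
      also have "(\<Sum>y\<in>P. \<Sum>y'\<in>P. a x y * v y ^ 6 / q * a x y') = (\<Sum>y\<in>P. a x y * v y ^ 6 / q * (\<Sum>y'\<in>P. a x y'))"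
        by (simp only: sum_distrib_left)
      also have "\<dots> \<le> (\<Sum>y\<in>P. a x y * v y ^ 6 / q * (2 * q))"
        using v q0 by (intro sum_mono mult_left_mono degree divide_nonneg_pos mult_nonneg_nonneg a_nonneg) auto
      also have "\<dots> = 2 * (\<Sum>y\<in>P. a x y * v y ^ 6)"
        unfolding sum_distrib_left using q0 by (intro sum.cong refl) auto
      finally show ?thesis by simp
    qed
    hence "(\<Sum>x\<in>P. E x) \<le> (\<Sum>x\<in>P. 2 * (\<Sum>y\<in>P. a x y * v y ^ 6) + q * K x + (\<Sum>y\<in>P. a x y * v y ^ 6))"
      by (intro sum_mono)
    also have "\<dots> = 3 * (\<Sum>x\<in>P. \<Sum>y\<in>P. a x y * v y ^ 6) + q * (\<Sum>x\<in>P. K x)"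
      by (simp only: sum.distrib flip: sum_distrib_left)
    also have "\<dots> \<le> 3 * (2 * q ^ 5) + q * (2 * q ^ 4)"
      using q0 six sum_K by (intro add_mono mult_left_mono) auto
    finally show ?thesis by (simp add: eval_nat_numeral)
  qed
  have "(\<Sum>x\<in>P. (\<Sum>y\<in>P. a x y * (v y)\<^sup>2) ^ 3) \<le> (\<Sum>x\<in>P. 6 * q * K x + 3 * E x)"
    by (intro sum_mono cube)
  also have "\<dots> = 6 * q * (\<Sum>x\<in>P. K x) + 3 * (\<Sum>x\<in>P. E x)"
    by (simp add: sum.distrib sum_distrib_left)
  also have "\<dots> \<le> 6 * q * (2 * q ^ 4) + 3 * (8 * q ^ 5)"
    using q0 sum_K sum_E by (intro add_mono mult_left_mono) auto
  finally show ?thesis by (simp add: eval_nat_numeral)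
qed

text \<open>The squares of u and v are the densities raised to 2/3. Pairing one of them with the
  circular sum B of the other would call for Hoelder with exponents 3/2 and 3; as the densities are
  normalised, Young's inequality balanced at B = q u does the same.\<close>

lemma edge_squares:
  assumes u: "\<And>x. 0 \<le> u x" and v: "\<And>x. 0 \<le> v x"
    and su: "(\<Sum>x\<in>P. u x ^ 3) \<le> q\<^sup>2" and sv: "(\<Sum>x\<in>P. v x ^ 3) \<le> q\<^sup>2"
  shows "(\<Sum>x\<in>P. \<Sum>y\<in>P. a x y * ((u x)\<^sup>2 * (v y)\<^sup>2)) \<le> 37 * q ^ 3"
proof -
  define B where "B x = (\<Sum>y\<in>P. a x y * (v y)\<^sup>2)" for x
  have q0: "0 < q" using q_ge_1 by simp
  have B0: "0 \<le> B x" for x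
    unfolding B_def by (intro sum_nonneg mult_nonneg_nonneg a_nonneg) auto
  have young: "(u x)\<^sup>2 * B x \<le> q * u x ^ 3 + B x ^ 3 / q\<^sup>2" for x
    using weighted_square_le_cubes[of "B x" "u x"] B0 u by (simp add: mult_ac)
  have "(\<Sum>x\<in>P. \<Sum>y\<in>P. a x y * ((u x)\<^sup>2 * (v y)\<^sup>2)) = (\<Sum>x\<in>P. (u x)\<^sup>2 * B x)"
    by (simp add: B_def sum_distrib_left mult_ac)
  also have "\<dots> \<le> (\<Sum>x\<in>P. q * u x ^ 3 + B x ^ 3 / q\<^sup>2)"
    by (intro sum_mono young)
  also have "\<dots> = q * (\<Sum>x\<in>P. u x ^ 3) + (\<Sum>x\<in>P. B x ^ 3) / q\<^sup>2"
    by (simp only: sum.distrib sum_distrib_left sum_divide_distrib)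
  also have "\<dots> \<le> q * q\<^sup>2 + 36 * q ^ 5 / q\<^sup>2"
    using q0 su edge_cubes[OF v sv] by (intro add_mono mult_left_mono divide_right_mono) (auto simp: B_def)
  also have "36 * q ^ 5 / q\<^sup>2 = 36 * q ^ 3"
    using q0 by (simp add: eval_nat_numeral)
  finally show ?thesis by (simp add: eval_nat_numeral)
qed

section \<open>Weights on three vertices: exponents (1/2, 1/2, 1/2)\<close>

text \<open>Pairs of triangles x y z and x y' z' with common vertex x, as they arise from squaring
  the triangle sum at x. The weight does not see x, so x can be summed out by codegrees.\<close>

definition bowties :: "('v \<Rightarrow> 'v \<Rightarrow> 'v \<Rightarrow> 'v \<Rightarrow> real) \<Rightarrow> real" where
  "bowties \<phi> = (\<Sum>x\<in>P. \<Sum>y\<in>P. \<Sum>z\<in>P. \<Sum>y'\<in>P. \<Sum>z'\<in>P. w x y z * w x y' z' * \<phi> y z y' z')"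

lemma bowties_mono: "(\<And>y z y' z'. \<phi> y z y' z' \<le> \<psi> y z y' z') \<Longrightarrow> bowties \<phi> \<le> bowties \<psi>"
  unfolding bowties_def by (intro sum_mono mult_left_mono mult_nonneg_nonneg w_nonneg)

lemma bowties_add:
  "bowties (\<lambda>y z y' z'. \<phi> y z y' z' + \<psi> y z y' z') = bowties \<phi> + bowties \<psi>"
  by (simp only: bowties_def sum.distrib distrib_left)

text \<open>Together with the swap inside both triangles, this reduces the six terms in
  \<open>triangles_squares\<close> to two estimates.\<close>

lemma bowties_swap_triangles: "bowties \<phi> = bowties (\<lambda>y z y' z'. \<phi> y' z' y z)"
proof -
  \<comment> \<open>With the vertices of each triangle paired up, a single interchange of sums
    exchanges the triangles.\<close>
  have "bowties \<phi> = (\<Sum>x\<in>P. \<Sum>r\<in>P \<times> P. \<Sum>r'\<in>P \<times> P.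
      w x (fst r) (snd r) * w x (fst r') (snd r') * \<phi> (fst r) (snd r) (fst r') (snd r'))" for \<phi>
    by (simp add: bowties_def sum.cartesian_product' split_def)
  from this[of \<phi>] this[of "\<lambda>y z y' z'. \<phi> y' z' y z"] show ?thesis
    by (simp add: mult_ac) (rule sum.cong[OF refl], subst sum.swap, simp add: mult_ac)
qed

lemma bowties_swap_vertices: "bowties \<phi> = bowties (\<lambda>y z y' z'. \<phi> z y z' y')"
proof -
  have "bowties (\<lambda>y z y' z'. \<phi> z y z' y') =
      (\<Sum>x\<in>P. \<Sum>z\<in>P. \<Sum>y\<in>P. \<Sum>y'\<in>P. \<Sum>z'\<in>P. w x y z * w x y' z' * \<phi> z y z' y')"
    unfolding bowties_def by (intro sum.cong refl sum.swap)
  also have "\<dots> = (\<Sum>x\<in>P. \<Sum>z\<in>P. \<Sum>y\<in>P. \<Sum>z'\<in>P. \<Sum>y'\<in>P. w x y z * w x y' z' * \<phi> z y z' y')"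
    by (intro sum.cong refl sum.swap)
  also have "\<dots> = bowties \<phi>"
    unfolding bowties_def by (intro sum.cong refl) (metis w_swap)
  finally show ?thesis ..
qed

lemma sum_w_le: "(\<Sum>z\<in>P. w x y z) \<le> 2"
  using sum_w[of x y] zero_or_one[of x y] by auto

lemma sum_w_first_le: "(\<Sum>x\<in>P. w x y z) \<le> 2"
  using sum_w_first[of y z] zero_or_one[of y z] by auto

text \<open>When y = y' both triangles contain the edge x y, so z' has at most two values; given y
  and z, so does x. The sums over y and z then separate, and 4 = 2 * 2.\<close>

lemma bowties_shared_edge:
  assumes G: "\<And>y. 0 \<le> G y" "sum G P \<le> q\<^sup>2" and H: "\<And>y. 0 \<le> H y" "sum H P \<le> q\<^sup>2"
  shows "bowties (\<lambda>y z y' z'. of_bool (y = y') * (G y * H z)) \<le> 4 * q ^ 4"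
proof -
  have S0: "0 \<le> sum G P" "0 \<le> sum H P" using G H by (auto intro: sum_nonneg)
  have "bowties (\<lambda>y z y' z'. of_bool (y = y') * (G y * H z)) =
      (\<Sum>x\<in>P. \<Sum>y\<in>P. \<Sum>z\<in>P. \<Sum>y'\<in>P. of_bool (y = y') * (w x y z * (G y * H z) * (\<Sum>z'\<in>P. w x y' z')))"
    by (simp add: bowties_def sum_distrib_left mult_ac)
  also have "\<dots> = (\<Sum>x\<in>P. \<Sum>y\<in>P. \<Sum>z\<in>P. w x y z * (G y * H z) * (\<Sum>z'\<in>P. w x y z'))"
    by (intro sum.cong refl sum_of_bool)
  also have "\<dots> \<le> (\<Sum>x\<in>P. \<Sum>y\<in>P. \<Sum>z\<in>P. w x y z * (G y * H z) * 2)"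
    by (intro sum_mono mult_left_mono sum_w_le mult_nonneg_nonneg w_nonneg G H)
  also have "\<dots> = (\<Sum>y\<in>P. \<Sum>x\<in>P. \<Sum>z\<in>P. w x y z * (G y * H z) * 2)"
    by (rule sum.swap)
  also have "\<dots> = (\<Sum>y\<in>P. \<Sum>z\<in>P. \<Sum>x\<in>P. w x y z * (G y * H z) * 2)"
    by (intro sum.cong refl sum.swap)
  also have "\<dots> = (\<Sum>y\<in>P. \<Sum>z\<in>P. (\<Sum>x\<in>P. w x y z) * (G y * H z * 2))"
    by (simp add: sum_distrib_left sum_distrib_right mult_ac)
  also have "\<dots> \<le> (\<Sum>y\<in>P. \<Sum>z\<in>P. 2 * (G y * H z * 2))"
    by (intro sum_mono mult_right_mono sum_w_first_le mult_nonneg_nonneg G H) auto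
  also have "\<dots> = 4 * (sum G P * sum H P)"
    unfolding sum_product by (simp add: sum_distrib_left mult_ac)
  also have "\<dots> \<le> 4 * (q\<^sup>2 * q\<^sup>2)"
    using G H S0 by (intro mult_left_mono mult_mono) auto
  finally show ?thesis by (simp add: power2_eq_square power4_eq_xxxx)
qed

text \<open>The unweighted z and z' have at most two values each; what remains is a cherry with
  distinct ends.\<close>

lemma bowties_distinct:
  assumes G: "\<And>y. 0 \<le> G y" "sum G P \<le> q\<^sup>2"
  shows "bowties (\<lambda>y z y' z'. of_bool (y \<noteq> y') * (G y * G y')) \<le> 8 * q ^ 4"
proof -
  let ?\<phi> = "\<lambda>y y'. of_bool (y \<noteq> y') * (G y * G y')"
  have "bowties (\<lambda>y z y' z'. ?\<phi> y y') =
      (\<Sum>x\<in>P. \<Sum>y\<in>P. \<Sum>y'\<in>P. \<Sum>z\<in>P. \<Sum>z'\<in>P. w x y z * w x y' z' * ?\<phi> y y')"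
    unfolding bowties_def by (intro sum.cong refl sum.swap)
  also have "\<dots> = (\<Sum>x\<in>P. \<Sum>y\<in>P. \<Sum>y'\<in>P. (\<Sum>z\<in>P. w x y z) * (\<Sum>z'\<in>P. w x y' z') * ?\<phi> y y')"
    by (simp only: sum_product) (simp only: sum_distrib_right)
  also have "\<dots> \<le> (\<Sum>x\<in>P. \<Sum>y\<in>P. \<Sum>y'\<in>P. (2 * a x y) * (2 * a x y') * ?\<phi> y y')"
    using a_nonneg G
    by (intro sum_mono mult_right_mono mult_mono sum_w mult_nonneg_nonneg sum_nonneg w_nonneg) auto
  also have "\<dots> = 4 * (\<Sum>x\<in>P. \<Sum>y\<in>P. \<Sum>y'\<in>P. a x y * a x y' * ?\<phi> y y')"
    unfolding sum_distrib_left by (intro sum.cong refl) simp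
  also have "\<dots> \<le> 4 * (2 * q ^ 4)"
    by (intro mult_left_mono sum_cherries G) auto
  finally show ?thesis by simp
qed

lemma mult_le_squares: "c * d \<le> c\<^sup>2 + d\<^sup>2" for c d :: real
proof -
  have "0 \<le> (c - d)\<^sup>2" "0 \<le> c\<^sup>2" "0 \<le> d\<^sup>2" by simp_all
  moreover have "(c - d)\<^sup>2 = c\<^sup>2 + d\<^sup>2 - 2 * (c * d)" by (simp add: power2_diff)
  ultimately show ?thesis by linarith
qed

lemma triangles_squares:
  assumes f: "\<And>x. 0 \<le> f x" "(\<Sum>x\<in>P. (f x)\<^sup>2) \<le> q\<^sup>2"
    and g: "\<And>x. 0 \<le> g x" "(\<Sum>x\<in>P. (g x)\<^sup>2) \<le> q\<^sup>2"
    and h: "\<And>x. 0 \<le> h x" "(\<Sum>x\<in>P. (h x)\<^sup>2) \<le> q\<^sup>2"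
  shows "(\<Sum>x\<in>P. \<Sum>y\<in>P. \<Sum>z\<in>P. w x y z * (f x * g y * h z)) \<le> 33 * q ^ 3"
proof -
  define G H where "G x = (g x)\<^sup>2" and "H x = (h x)\<^sup>2" for x
  have G: "\<And>x. 0 \<le> G x" "sum G P \<le> q\<^sup>2" and H: "\<And>x. 0 \<le> H x" "sum H P \<le> q\<^sup>2"
    using g h by (simp_all add: G_def H_def)
  have q0: "0 < q" using q_ge_1 by simp
  define B where "B x = (\<Sum>y\<in>P. \<Sum>z\<in>P. w x y z * (g y * h z))" for x
  have pointwise: "(g y * h z) * (g y' * h z') \<le>
      (of_bool (y = y') * (G y * H z) + of_bool (y' = y) * (G y' * H z')) +
      (of_bool (z = z') * (H z * G y) + of_bool (z' = z) * (H z' * G y')) +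
      (of_bool (y \<noteq> y') * (G y * G y') + of_bool (z \<noteq> z') * (H z * H z'))" for y z y' z'
  proof -
    have nn: "0 \<le> of_bool b * (c * d)" if "0 \<le> c" "0 \<le> d" for b and c d :: real
      using that by simp
    note nn' = nn[OF G(1) H(1)] nn[OF H(1) G(1)] nn[OF G(1) G(1)] nn[OF H(1) H(1)]
    consider "y = y'" | "z = z'" | "y \<noteq> y'" "z \<noteq> z'" by blast
    thus ?thesis
    proof cases
      case 1
      have "(g y * h z) * (g y' * h z') = G y * (h z * h z')"
        using 1 by (simp add: G_def power2_eq_square)
      also have "\<dots> \<le> G y * (H z + H z')"
        unfolding H_def by (intro mult_left_mono mult_le_squares G)
      also have "\<dots> = of_bool (y = y') * (G y * H z) + of_bool (y' = y) * (G y' * H z')"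
        using 1 by (simp add: distrib_left)
      finally show ?thesis
        using nn'(2)[of "z = z'" z y] nn'(2)[of "z' = z" z' y'] nn'(3)[of "y \<noteq> y'" y y']
          nn'(4)[of "z \<noteq> z'" z z'] by linarith
    next
      case 2
      have "(g y * h z) * (g y' * h z') = H z * (g y * g y')"
        using 2 by (simp add: H_def power2_eq_square)
      also have "\<dots> \<le> H z * (G y + G y')"
        unfolding G_def by (intro mult_left_mono mult_le_squares H)
      also have "\<dots> = of_bool (z = z') * (H z * G y) + of_bool (z' = z) * (H z' * G y')"
        using 2 by (simp add: distrib_left)
      finally show ?thesis
        using nn'(1)[of "y = y'" y z] nn'(1)[of "y' = y" y' z'] nn'(3)[of "y \<noteq> y'" y y']
          nn'(4)[of "z \<noteq> z'" z z'] by linarith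
    next
      case 3
      have "(g y * h z) * (g y' * h z') = (g y * g y') * (h z * h z')" by simp
      \<comment> \<open>Separating \<open>g\<close> from \<open>h\<close> leaves two vertices of the
        bowtie without weight, so \<open>bowties_distinct\<close> applies to each summand.\<close>
      also have "\<dots> \<le> (g y * g y')\<^sup>2 + (h z * h z')\<^sup>2" by (rule mult_le_squares)
      finally show ?thesis using 3 by (simp add: G_def H_def power_mult_distrib)
    qed
  qed
  have "(\<Sum>x\<in>P. (B x)\<^sup>2) = bowties (\<lambda>y z y' z'. (g y * h z) * (g y' * h z'))"
    unfolding B_def bowties_def power2_eq_square sum_product
    by (simp add: sum_distrib_left sum_distrib_right mult_ac)
       (intro sum.cong refl sum.swap)
  also have "\<dots> \<le> bowties (\<lambda>y z y' z'.
      (of_bool (y = y') * (G y * H z) + of_bool (y' = y) * (G y' * H z')) +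
      (of_bool (z = z') * (H z * G y) + of_bool (z' = z) * (H z' * G y')) +
      (of_bool (y \<noteq> y') * (G y * G y') + of_bool (z \<noteq> z') * (H z * H z')))"
    by (rule bowties_mono) (rule pointwise)
  also have "\<dots> = (bowties (\<lambda>y z y' z'. of_bool (y = y') * (G y * H z)) +
        bowties (\<lambda>y z y' z'. of_bool (y' = y) * (G y' * H z'))) +
      (bowties (\<lambda>y z y' z'. of_bool (z = z') * (H z * G y)) +
        bowties (\<lambda>y z y' z'. of_bool (z' = z) * (H z' * G y'))) +
      (bowties (\<lambda>y z y' z'. of_bool (y \<noteq> y') * (G y * G y')) +
        bowties (\<lambda>y z y' z'. of_bool (z \<noteq> z') * (H z * H z')))"
    by (simp only: bowties_add)
  also have "\<dots> \<le> (4 * q ^ 4 + 4 * q ^ 4) + (4 * q ^ 4 + 4 * q ^ 4) + (8 * q ^ 4 + 8 * q ^ 4)"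
  proof (intro add_mono)
    note e = bowties_shared_edge
    show "bowties (\<lambda>y z y' z'. of_bool (y = y') * (G y * H z)) \<le> 4 * q ^ 4"
      by (intro e G H)
    show "bowties (\<lambda>y z y' z'. of_bool (y' = y) * (G y' * H z')) \<le> 4 * q ^ 4"
      by (subst bowties_swap_triangles) (intro e G H)
    show "bowties (\<lambda>y z y' z'. of_bool (z = z') * (H z * G y)) \<le> 4 * q ^ 4"
      by (subst bowties_swap_vertices) (intro e G H)
    show "bowties (\<lambda>y z y' z'. of_bool (z' = z) * (H z' * G y')) \<le> 4 * q ^ 4"
      by (subst bowties_swap_triangles, subst bowties_swap_vertices) (intro e G H)
    show "bowties (\<lambda>y z y' z'. of_bool (y \<noteq> y') * (G y * G y')) \<le> 8 * q ^ 4"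
      by (intro bowties_distinct G)
    show "bowties (\<lambda>y z y' z'. of_bool (z \<noteq> z') * (H z * H z')) \<le> 8 * q ^ 4"
      by (subst bowties_swap_vertices) (intro bowties_distinct H)
  qed
  finally have sum_B: "(\<Sum>x\<in>P. (B x)\<^sup>2) \<le> 32 * q ^ 4" by simp
  \<comment> \<open>The total of f^2 is at most q^2 and that of B^2 is O(q^4); the weights q and 1/q
    bring both to q^3.\<close>
  have fB: "f x * B x \<le> q * (f x)\<^sup>2 + (B x)\<^sup>2 / q" for x
  proof -
    have "(sqrt q * f x) * (B x / sqrt q) \<le> (sqrt q * f x)\<^sup>2 + (B x / sqrt q)\<^sup>2"
      by (rule mult_le_squares)
    thus ?thesis using q0 by (simp add: power_mult_distrib power_divide)
  qed
  have "(\<Sum>x\<in>P. \<Sum>y\<in>P. \<Sum>z\<in>P. w x y z * (f x * g y * h z)) = (\<Sum>x\<in>P. f x * B x)"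
    by (simp add: B_def sum_distrib_left mult_ac)
  also have "\<dots> \<le> (\<Sum>x\<in>P. q * (f x)\<^sup>2 + (B x)\<^sup>2 / q)"
    by (intro sum_mono fB)
  also have "\<dots> = q * (\<Sum>x\<in>P. (f x)\<^sup>2) + (\<Sum>x\<in>P. (B x)\<^sup>2) / q"
    by (simp only: sum.distrib sum_distrib_left sum_divide_distrib)
  also have "\<dots> \<le> q * q\<^sup>2 + 32 * q ^ 4 / q"
    using q0 f sum_B by (intro add_mono mult_left_mono divide_right_mono) auto
  finally show ?thesis using q0 by (simp add: eval_nat_numeral)
qed

lemma triangles_powr:
  fixes \<alpha> \<beta> \<gamma> :: real
  assumes F: "\<And>x. 0 \<le> F x" "sum F P \<le> q\<^sup>2" and G: "\<And>x. 0 \<le> G x" "sum G P \<le> q\<^sup>2"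
    and H: "\<And>x. 0 \<le> H x" "sum H P \<le> q\<^sup>2"
    and ex: "0 \<le> \<alpha>" "0 \<le> \<beta>" "0 \<le> \<gamma>"
      "2 * \<alpha> + \<beta> + \<gamma> \<le> 2" "\<alpha> + 2 * \<beta> + \<gamma> \<le> 2" "\<alpha> + \<beta> + 2 * \<gamma> \<le> 2"
  shows "(\<Sum>x\<in>P. \<Sum>y\<in>P. \<Sum>z\<in>P. w x y z * (F x powr \<alpha> * G y powr \<beta> * H z powr \<gamma>)) \<le> 271 * q ^ 3"
proof -
  let ?c = "\<lambda>F x. F x powr (1/3) :: real"
  have cubes: "?c F x ^ 3 = F x" if "\<And>x. 0 \<le> F x" for F and x :: 'v
    using that[of x] by (cases "F x = 0") (simp_all add: powr_powr flip: powr_numeral)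
  have pair: "(\<Sum>x\<in>P. \<Sum>y\<in>P. \<Sum>z\<in>P. w x y z * ((?c F x)\<^sup>2 * (?c G y)\<^sup>2)) \<le> 74 * q ^ 3"
    if "\<And>x. 0 \<le> F x" "sum F P \<le> q\<^sup>2" "\<And>x. 0 \<le> G x" "sum G P \<le> q\<^sup>2" for F G
  proof -
    have "(\<Sum>x\<in>P. \<Sum>y\<in>P. \<Sum>z\<in>P. w x y z * ((?c F x)\<^sup>2 * (?c G y)\<^sup>2)) \<le>
        2 * (\<Sum>x\<in>P. \<Sum>y\<in>P. a x y * ((?c F x)\<^sup>2 * (?c G y)\<^sup>2))"
      by (intro triangles_pair) simp
    also have "\<dots> \<le> 2 * (37 * q ^ 3)"
      using that by (intro mult_left_mono edge_squares) (simp_all add: cubes)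
    finally show ?thesis by simp
  qed
  have "(\<Sum>x\<in>P. \<Sum>y\<in>P. \<Sum>z\<in>P. w x y z * (F x powr \<alpha> * G y powr \<beta> * H z powr \<gamma>)) \<le>
      (\<Sum>x\<in>P. \<Sum>y\<in>P. \<Sum>z\<in>P. w x y z * (1 + (F x + G y + H z) +
        ((?c F x)\<^sup>2 * (?c G y)\<^sup>2 + (?c G y)\<^sup>2 * (?c H z)\<^sup>2 + (?c H z)\<^sup>2 * (?c F x)\<^sup>2) +
        sqrt (F x) * sqrt (G y) * sqrt (H z)))"
    using F G H ex by (intro sum_mono mult_left_mono powr_le_vertices w_nonneg) auto
  also have "\<dots> = (\<Sum>x\<in>P. \<Sum>y\<in>P. \<Sum>z\<in>P. w x y z) +
      ((\<Sum>x\<in>P. \<Sum>y\<in>P. \<Sum>z\<in>P. w x y z * F x) + (\<Sum>x\<in>P. \<Sum>y\<in>P. \<Sum>z\<in>P. w x y z * G y) +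
       (\<Sum>x\<in>P. \<Sum>y\<in>P. \<Sum>z\<in>P. w x y z * H z)) +
      ((\<Sum>x\<in>P. \<Sum>y\<in>P. \<Sum>z\<in>P. w x y z * ((?c F x)\<^sup>2 * (?c G y)\<^sup>2)) +
       (\<Sum>x\<in>P. \<Sum>y\<in>P. \<Sum>z\<in>P. w x y z * ((?c G y)\<^sup>2 * (?c H z)\<^sup>2)) +
       (\<Sum>x\<in>P. \<Sum>y\<in>P. \<Sum>z\<in>P. w x y z * ((?c H z)\<^sup>2 * (?c F x)\<^sup>2))) +
      (\<Sum>x\<in>P. \<Sum>y\<in>P. \<Sum>z\<in>P. w x y z * (sqrt (F x) * sqrt (G y) * sqrt (H z)))"
    by (simp only: distrib_left sum.distrib mult_1_right)
  \<comment> \<open>One term for (0,0,0), three for (1,0,0), three for (2/3,2/3,0) and one for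
    (1/2,1/2,1/2): 4 + 12 + 222 + 33 = 271.\<close>
  also have "\<dots> \<le> 4 * q ^ 3 + (4 * q ^ 3 + 4 * q ^ 3 + 4 * q ^ 3) +
      (74 * q ^ 3 + 74 * q ^ 3 + 74 * q ^ 3) + 33 * q ^ 3"
  proof (intro add_mono)
    show "(\<Sum>x\<in>P. \<Sum>y\<in>P. \<Sum>z\<in>P. w x y z) \<le> 4 * q ^ 3"
      by (rule triangles_count)
    show "(\<Sum>x\<in>P. \<Sum>y\<in>P. \<Sum>z\<in>P. w x y z * F x) \<le> 4 * q ^ 3"
      by (rule triangles_vertex) fact+
    show "(\<Sum>x\<in>P. \<Sum>y\<in>P. \<Sum>z\<in>P. w x y z * G y) \<le> 4 * q ^ 3"
      unfolding sum_w_rotate[of "\<lambda>x y z. G y"] by (rule triangles_vertex) fact+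
    show "(\<Sum>x\<in>P. \<Sum>y\<in>P. \<Sum>z\<in>P. w x y z * H z) \<le> 4 * q ^ 3"
      \<comment> \<open>A rotation moves a weight from z to y, and a second one from y to x.\<close>
      unfolding sum_w_rotate[of "\<lambda>x y z. H z"]
      unfolding sum_w_rotate[of "\<lambda>x y z. H y"] by (rule triangles_vertex) fact+
    show "(\<Sum>x\<in>P. \<Sum>y\<in>P. \<Sum>z\<in>P. w x y z * ((?c F x)\<^sup>2 * (?c G y)\<^sup>2)) \<le> 74 * q ^ 3"
      by (rule pair) fact+
    show "(\<Sum>x\<in>P. \<Sum>y\<in>P. \<Sum>z\<in>P. w x y z * ((?c G y)\<^sup>2 * (?c H z)\<^sup>2)) \<le> 74 * q ^ 3"
      unfolding sum_w_rotate[of "\<lambda>x y z. (?c G y)\<^sup>2 * (?c H z)\<^sup>2"] by (rule pair) fact+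
    show "(\<Sum>x\<in>P. \<Sum>y\<in>P. \<Sum>z\<in>P. w x y z * ((?c H z)\<^sup>2 * (?c F x)\<^sup>2)) \<le> 74 * q ^ 3"
      unfolding sum_w_rotate[of "\<lambda>x y z. (?c H z)\<^sup>2 * (?c F x)\<^sup>2"]
      unfolding sum_w_rotate[of "\<lambda>x y z. (?c H y)\<^sup>2 * (?c F z)\<^sup>2"] by (rule pair) fact+
    show "(\<Sum>x\<in>P. \<Sum>y\<in>P. \<Sum>z\<in>P. w x y z * (sqrt (F x) * sqrt (G y) * sqrt (H z))) \<le> 33 * q ^ 3"
      using F G H by (intro triangles_squares) simp_all
  qed
  finally show ?thesis by simp
qed

end

section \<open>Circles in a plane over a finite field\<close>

lemma card_le_mult_fibers:
  assumes "finite A" and "\<And>c. card {x \<in> A. f x = c} \<le> k"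
  shows "card A \<le> k * card (f ` A)"
proof -
  have "A = (\<Union>c\<in>f ` A. {x \<in> A. f x = c})" by auto
  hence "card A \<le> (\<Sum>c\<in>f ` A. card {x \<in> A. f x = c})"
    using assms(1) card_UN_le[of "f ` A" "\<lambda>c. {x \<in> A. f x = c}"] by simp
  also have "\<dots> \<le> card (f ` A) * k"
    using sum_bounded_above[of "f ` A" "\<lambda>c. card {x \<in> A. f x = c}" k] assms(2) by simp
  finally show ?thesis by (simp add: mult.commute)
qed

context field
begin

abbreviation two :: 'a where "two \<equiv> \<one> \<oplus> \<one>"

lemma square_roots:
  assumes "x \<in> carrier R" "y \<in> carrier R" "x \<otimes> x = y \<otimes> y"
  shows "x = y \<or> x = \<ominus> y"
proof -
  have "(x \<ominus> y) \<otimes> (x \<oplus> y) = x \<otimes> x \<ominus> y \<otimes> y" using assms(1,2) by algebra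
  also have "\<dots> = \<zero>" using assms by simp
  finally have "(x \<ominus> y) \<otimes> (x \<oplus> y) = \<zero>" .
  from integral[OF this] have "x \<ominus> y = \<zero> \<or> x \<oplus> y = \<zero>" using assms(1,2) by auto
  thus ?thesis
  proof
    assume "x \<ominus> y = \<zero>" thus ?thesis using assms by (simp add: r_right_minus_eq)
  next
    assume "x \<oplus> y = \<zero>" thus ?thesis using assms minus_equality by blast
  qed
qed

lemma card_square_roots: "card {x \<in> carrier R. x \<otimes> x = c} \<le> 2"
proof (cases "\<exists>r\<in>carrier R. r \<otimes> r = c")
  case True
  then obtain r where r: "r \<in> carrier R" "r \<otimes> r = c" by blast
  have "{x \<in> carrier R. x \<otimes> x = c} \<subseteq> {r, \<ominus> r}"
    using r square_roots by auto
  hence "card {x \<in> carrier R. x \<otimes> x = c} \<le> card {r, \<ominus> r}"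
    by (intro card_mono) auto
  also have "\<dots> \<le> 2" using card_insert_le_m1[of 2 "{\<ominus> r}" r] by simp
  finally show ?thesis .
next
  case False
  hence "{x \<in> carrier R. x \<otimes> x = c} = {}" by blast
  thus ?thesis by (metis card.empty zero_le)
qed

text \<open>If 1 + 1 = 0, an odd multiple of 1 is 1; but the multiple by the order of the additive
  group is 0.\<close>

lemma two_nonzero:
  assumes "odd (card (carrier R))"
  shows "two \<noteq> \<zero>"
proof
  assume 2: "two = \<zero>"
  obtain k where k: "card (carrier R) = Suc (2 * k)" using assms oddE by fastforce
  have "[card (carrier R)] \<cdot> \<one> = \<zero>"
    using add.pow_order_eq_1[of \<one>] by (simp add: order_def)
  moreover have "[card (carrier R)] \<cdot> \<one> = \<one>"
  proof -
    have "[(2 * k)] \<cdot> \<one> = \<zero>"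
      using 2 by (induction k) (simp_all add: add.m_assoc)
    thus ?thesis unfolding k by simp
  qed
  ultimately show False by simp
qed

lemma cancel_left:
  assumes "c \<otimes> x = c \<otimes> y" "c \<noteq> \<zero>" "c \<in> carrier R" "x \<in> carrier R" "y \<in> carrier R"
  shows "x = y"
  using assms by (simp add: m_lcancel)

lemma plane_minus_closed: "x \<in> plane R \<Longrightarrow> y \<in> plane R \<Longrightarrow> plane_minus R x y \<in> plane R"
  by (auto simp: plane_def plane_minus_def)

text \<open>With \<open>e = y' - y\<close> and \<open>u = x - y\<close>, the inner product of \<open>u\<close> and \<open>e\<close> is determined, and the
  sum of its square and the square \<open>C u ^ 2\<close> of the determinant is \<open>t * N\<close>, so two values remain for
  \<open>C u\<close>. A nonzero isotropic \<open>e\<close> (\<open>N = 0\<close>) would be orthogonal to \<open>u\<close> and parallel to it,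
  contradicting \<open>t \<noteq> 0\<close>.\<close>

lemma circles_meet:
  assumes "two \<noteq> \<zero>" "t \<in> carrier R" "t \<noteq> \<zero>" "finite (carrier R)"
    and y: "y \<in> plane R" "y' \<in> plane R" "y \<noteq> y'"
  shows "card {x \<in> plane R. plane_minus R x y \<in> circle R t \<and> plane_minus R x y' \<in> circle R t} \<le> 2"
    (is "card ?A \<le> 2")
proof -
  obtain y1 y2 y1' y2' where yy: "y = (y1, y2)" "y' = (y1', y2')" by fastforce
  have yc: "y1 \<in> carrier R" "y2 \<in> carrier R" "y1' \<in> carrier R" "y2' \<in> carrier R"
    using y unfolding yy by (auto simp: plane_def)
  define e1 e2 where "e1 = y1' \<ominus> y1" and "e2 = y2' \<ominus> y2"
  have ec: "e1 \<in> carrier R" "e2 \<in> carrier R" using yc by (simp_all add: e1_def e2_def)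
  have e0: "\<not> (e1 = \<zero> \<and> e2 = \<zero>)"
    using yc y(3) by (auto simp: e1_def e2_def yy r_right_minus_eq)
  define N where "N = e1 \<otimes> e1 \<oplus> e2 \<otimes> e2"
  have Nc: "N \<in> carrier R" using ec by (simp add: N_def)
  \<comment> \<open>Formally D + iC is the conjugate of u times e. Hence D and C determine u when N
    is nonzero, and determine e when the norm t of u is nonzero.\<close>
  define D where "D u = fst u \<otimes> e1 \<oplus> snd u \<otimes> e2" for u
  define C where "C u = fst u \<otimes> e2 \<ominus> snd u \<otimes> e1" for u
  let ?u = "\<lambda>x. plane_minus R x y"
  have A: "?u x \<in> plane R" "D (?u x) \<in> carrier R" "C (?u x) \<in> carrier R"
      "two \<otimes> D (?u x) = N" "D (?u x) \<otimes> D (?u x) \<oplus> C (?u x) \<otimes> C (?u x) = t \<otimes> N"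
      "sq_norm R (?u x) = t" if "x \<in> ?A" for x
  proof -
    obtain x1 x2 where x: "x = (x1, x2)" by fastforce
    have xc: "x1 \<in> carrier R" "x2 \<in> carrier R" using that unfolding x by (auto simp: plane_def)
    define u1 u2 where "u1 = x1 \<ominus> y1" and "u2 = x2 \<ominus> y2"
    have uc: "u1 \<in> carrier R" "u2 \<in> carrier R" using xc yc by (simp_all add: u1_def u2_def)
    have u: "?u x = (u1, u2)" by (simp add: x yy plane_minus_def u1_def u2_def)
    have u': "plane_minus R x y' = (u1 \<ominus> e1, u2 \<ominus> e2)"
    proof -
      have "x1 \<ominus> y1' = u1 \<ominus> e1" using xc yc unfolding u1_def e1_def by algebra
      moreover have "x2 \<ominus> y2' = u2 \<ominus> e2" using xc yc unfolding u2_def e2_def by algebra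
      ultimately show ?thesis by (simp add: x yy plane_minus_def)
    qed
    show "?u x \<in> plane R" "D (?u x) \<in> carrier R" "C (?u x) \<in> carrier R"
      using uc ec by (simp_all add: u plane_def D_def C_def)
    have t1: "u1 \<otimes> u1 \<oplus> u2 \<otimes> u2 = t"
      using that by (simp add: circle_def sq_norm_def u)
    thus "sq_norm R (?u x) = t" by (simp add: sq_norm_def u)
    have t2: "(u1 \<ominus> e1) \<otimes> (u1 \<ominus> e1) \<oplus> (u2 \<ominus> e2) \<otimes> (u2 \<ominus> e2) = t"
      using that by (simp add: circle_def sq_norm_def u')
    have "two \<otimes> (u1 \<otimes> e1 \<oplus> u2 \<otimes> e2) =
        (u1 \<otimes> u1 \<oplus> u2 \<otimes> u2) \<ominus> ((u1 \<ominus> e1) \<otimes> (u1 \<ominus> e1) \<oplus> (u2 \<ominus> e2) \<otimes> (u2 \<ominus> e2)) \<oplus> N"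
      unfolding N_def using uc ec by algebra
    also have "\<dots> = N" unfolding t1 t2 using assms Nc by algebra
    finally show "two \<otimes> D (?u x) = N" by (simp add: D_def u)
    have "D (?u x) \<otimes> D (?u x) \<oplus> C (?u x) \<otimes> C (?u x) = (u1 \<otimes> u1 \<oplus> u2 \<otimes> u2) \<otimes> N"
      unfolding D_def C_def u fst_conv snd_conv N_def using uc ec by algebra
    thus "D (?u x) \<otimes> D (?u x) \<oplus> C (?u x) \<otimes> C (?u x) = t \<otimes> N" by (simp add: t1)
  qed
  show ?thesis
  proof (cases "?A = {}")
    case True
    thus ?thesis by (metis card.empty zero_le)
  next
    case False
    then obtain x0 where x0: "x0 \<in> ?A" by blast
    have Deq: "D (?u x) = D (?u x0)" if "x \<in> ?A" for x
      using cancel_left[of two "D (?u x)" "D (?u x0)"] A[OF that] A[OF x0] assms(1) by simp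
    have N0: "N \<noteq> \<zero>"
    proof
      assume N0: "N = \<zero>"
      obtain u1 u2 where u: "?u x0 = (u1, u2)" by fastforce
      have uc: "u1 \<in> carrier R" "u2 \<in> carrier R" using A(1)[OF x0] by (auto simp: u plane_def)
      have D0: "D (?u x0) = \<zero>"
        using cancel_left[of two "D (?u x0)" \<zero>] A[OF x0] assms(1) N0 by simp
      have "C (?u x0) \<otimes> C (?u x0) = \<zero>"
        using A(5)[OF x0] A(3)[OF x0] assms(2) by (simp add: D0 N0)
      hence C0: "C (?u x0) = \<zero>" using A(3)[OF x0] integral by blast
      have t: "t = u1 \<otimes> u1 \<oplus> u2 \<otimes> u2" using A(6)[OF x0] by (simp add: sq_norm_def u)
      \<comment> \<open>Here e is recovered from D and C after multiplication by t, which works even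
        for isotropic e.\<close>
      have "t \<otimes> e1 = u1 \<otimes> D (?u x0) \<ominus> u2 \<otimes> C (?u x0)"
        unfolding D_def C_def u fst_conv snd_conv t using uc ec by algebra
      hence "t \<otimes> e1 = \<zero>" using uc by (simp add: D0 C0)
      moreover have "t \<otimes> e2 = u2 \<otimes> D (?u x0) \<oplus> u1 \<otimes> C (?u x0)"
        unfolding D_def C_def u fst_conv snd_conv t using uc ec by algebra
      hence "t \<otimes> e2 = \<zero>" using uc by (simp add: D0 C0)
      ultimately show False using e0 integral assms(2,3) ec by blast
    qed
    define K where "K = t \<otimes> N \<ominus> D (?u x0) \<otimes> D (?u x0)"
    have "(\<lambda>x. C (?u x)) ` ?A \<subseteq> {c \<in> carrier R. c \<otimes> c = K}"
    proof safe
      fix x assume "x \<in> plane R" "plane_minus R x y \<in> circle R t" "plane_minus R x y' \<in> circle R t"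
      hence x: "x \<in> ?A" by blast
      show "C (?u x) \<in> carrier R" using A[OF x] by blast
      have "C (?u x) \<otimes> C (?u x) =
          (D (?u x) \<otimes> D (?u x) \<oplus> C (?u x) \<otimes> C (?u x)) \<ominus> D (?u x) \<otimes> D (?u x)"
        using A(2,3)[OF x] by algebra
      also have "\<dots> = t \<otimes> N \<ominus> D (?u x) \<otimes> D (?u x)" by (simp only: A(5)[OF x])
      also have "\<dots> = K" by (simp only: K_def Deq[OF x])
      finally show "C (?u x) \<otimes> C (?u x) = K" .
    qed
    moreover have "inj_on (\<lambda>x. C (?u x)) ?A"
    proof (rule inj_onI)
      fix x x' assume x: "x \<in> ?A" "x' \<in> ?A" and C: "C (?u x) = C (?u x')"
      have rec: "N \<otimes> fst (?u x) = D (?u x) \<otimes> e1 \<oplus> C (?u x) \<otimes> e2"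
        "N \<otimes> snd (?u x) = D (?u x) \<otimes> e2 \<ominus> C (?u x) \<otimes> e1" if "x \<in> ?A" for x
      proof -
        have c: "fst (?u x) \<in> carrier R" "snd (?u x) \<in> carrier R"
          using A(1)[OF that] by (auto simp: plane_def)
        show "N \<otimes> fst (?u x) = D (?u x) \<otimes> e1 \<oplus> C (?u x) \<otimes> e2"
          unfolding D_def C_def N_def using c ec by algebra
        show "N \<otimes> snd (?u x) = D (?u x) \<otimes> e2 \<ominus> C (?u x) \<otimes> e1"
          unfolding D_def C_def N_def using c ec by algebra
      qed
      have "D (?u x) = D (?u x')" using Deq x by simp
      hence "N \<otimes> fst (?u x) = N \<otimes> fst (?u x')" "N \<otimes> snd (?u x) = N \<otimes> snd (?u x')"
        using rec[OF x(1)] rec[OF x(2)] C by simp_all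
      hence "fst (?u x) = fst (?u x')" "snd (?u x) = snd (?u x')"
        using cancel_left[OF _ N0 Nc] A(1)[OF x(1)] A(1)[OF x(2)] by (auto simp: plane_def)
      hence "fst x \<ominus> y1 = fst x' \<ominus> y1" "snd x \<ominus> y2 = snd x' \<ominus> y2"
        by (simp_all add: plane_minus_def yy)
      thus "x = x'"
        using x yc by (intro prod_eqI) (auto simp: plane_def a_minus_def)
    qed
    ultimately have "card ?A \<le> card {c \<in> carrier R. c \<otimes> c = K}"
      using assms(4) by (intro card_inj_on_le) auto
    thus ?thesis using card_square_roots[of K] by linarith
  qed
qed

text \<open>Given the first coordinate, the second is a square root of a fixed element.\<close>

lemma card_circle_le:
  assumes "finite (carrier R)" "t \<in> carrier R"
  shows "card (circle R t) \<le> 2 * card (carrier R)"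
proof -
  have fin: "finite (circle R t)"
    using assms by (auto simp: circle_def plane_def)
  have "card {x \<in> circle R t. fst x = c} \<le> 2" for c
  proof (cases "c \<in> carrier R")
    case True
    have "snd ` {x \<in> circle R t. fst x = c} \<subseteq> {d \<in> carrier R. d \<otimes> d = t \<ominus> c \<otimes> c}"
    proof (rule image_subsetI)
      fix p assume "p \<in> {x \<in> circle R t. fst x = c}"
      then obtain d where p: "p = (c, d)" and d: "(c, d) \<in> circle R t" by (cases p) auto
      have dc: "d \<in> carrier R" and t: "t = c \<otimes> c \<oplus> d \<otimes> d"
        using d by (auto simp: circle_def plane_def sq_norm_def)
      have "d \<otimes> d = t \<ominus> c \<otimes> c" unfolding t using dc True by algebra
      thus "snd p \<in> {d \<in> carrier R. d \<otimes> d = t \<ominus> c \<otimes> c}" using dc by (simp add: p)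
    qed
    moreover have "inj_on snd {x \<in> circle R t. fst x = c}" by (auto intro!: inj_onI prod_eqI)
    ultimately have "card {x \<in> circle R t. fst x = c} \<le> card {d \<in> carrier R. d \<otimes> d = t \<ominus> c \<otimes> c}"
      using assms by (intro card_inj_on_le) auto
    thus ?thesis using card_square_roots le_trans by blast
  next
    case False
    hence "{x \<in> circle R t. fst x = c} = {}" by (auto simp: circle_def plane_def)
    thus ?thesis by (metis card.empty zero_le)
  qed
  hence "card (circle R t) \<le> 2 * card (fst ` circle R t)"
    by (intro card_le_mult_fibers fin)
  also have "card (fst ` circle R t) \<le> card (carrier R)"
    using assms by (intro card_mono) (auto simp: circle_def plane_def)
  finally show ?thesis by simp
qed

text \<open>Pigeonhole: more than half of the elements are squares, so the squares meet their
  reflection under c \<mapsto> t - c.\<close>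

lemma circle_nonempty:
  assumes "finite (carrier R)" "odd (card (carrier R))" "t \<in> carrier R"
  shows "\<exists>a\<in>carrier R. \<exists>b\<in>carrier R. a \<otimes> a \<oplus> b \<otimes> b = t"
proof -
  let ?S = "(\<lambda>a. a \<otimes> a) ` carrier R"
  have "card (carrier R) \<le> 2 * card ?S"
    using assms(1) card_square_roots by (intro card_le_mult_fibers) auto
  \<comment> \<open>Strict because the order of the field is odd.\<close>
  hence S: "card (carrier R) < 2 * card ?S" using assms(2) by (metis dvd_triv_left le_neq_implies_less)
  let ?T = "(\<lambda>c. t \<ominus> c) ` ?S"
  have "inj_on (\<lambda>c. t \<ominus> c) ?S"
  proof (rule inj_onI)
    fix c d assume cd: "c \<in> ?S" "d \<in> ?S" "t \<ominus> c = t \<ominus> d"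
    hence c: "c \<in> carrier R" "d \<in> carrier R" by auto
    have "c = t \<ominus> (t \<ominus> c)" using c assms(3) by algebra
    also have "\<dots> = d" unfolding cd(3) using c assms(3) by algebra
    finally show "c = d" .
  qed
  hence T: "card ?T = card ?S" by (rule card_image)
  have "?S \<inter> ?T \<noteq> {}"
  proof
    assume "?S \<inter> ?T = {}"
    hence "card ?S + card ?T = card (?S \<union> ?T)"
      using assms(1) by (intro card_Un_disjoint[symmetric]) auto
    also have "\<dots> \<le> card (carrier R)"
      using assms by (intro card_mono) auto
    finally show False using S T by linarith
  qed
  then obtain a b where ab: "a \<in> carrier R" "b \<in> carrier R" "a \<otimes> a = t \<ominus> b \<otimes> b" by auto
  have "a \<otimes> a \<oplus> b \<otimes> b = t" unfolding ab(3) using ab assms by algebra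
  with ab show ?thesis by blast
qed

text \<open>The rational parametrisation of the unit circle, rotating a given point of \<open>circle R t\<close>.\<close>

lemma card_circle_ge:
  assumes "finite (carrier R)" "odd (card (carrier R))" "t \<in> carrier R" "t \<noteq> \<zero>"
  shows "card (carrier R) \<le> card (circle R t) + 2"
proof -
  note 2 = two_nonzero[OF assms(2)]
  obtain a b where ab: "a \<in> carrier R" "b \<in> carrier R" "a \<otimes> a \<oplus> b \<otimes> b = t"
    using circle_nonempty[OF assms(1-3)] by blast
  \<comment> \<open>The parametrisation has poles where m^2 = -1; these at most two parameters
    account for the 2 in the bound.\<close>
  define M where "M = {m \<in> carrier R. \<one> \<oplus> m \<otimes> m \<noteq> \<zero>}"
  define k where "k m = inv (\<one> \<oplus> m \<otimes> m)" for m
  define c where "c m = (\<one> \<ominus> m \<otimes> m) \<otimes> k m" for m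
  define s where "s m = two \<otimes> m \<otimes> k m" for m
  define Q where "Q m = (c m \<otimes> a \<ominus> s m \<otimes> b, s m \<otimes> a \<oplus> c m \<otimes> b)" for m
  have M: "m \<in> carrier R" "k m \<in> carrier R" "(\<one> \<oplus> m \<otimes> m) \<otimes> k m = \<one>" "k m \<noteq> \<zero>"
      "c m \<in> carrier R" "s m \<in> carrier R" if "m \<in> M" for m
  proof -
    show m: "m \<in> carrier R" using that by (simp add: M_def)
    have u: "\<one> \<oplus> m \<otimes> m \<in> Units R" using that by (simp add: M_def field_Units)
    show kc: "k m \<in> carrier R" using u by (simp add: k_def)
    show k1: "(\<one> \<oplus> m \<otimes> m) \<otimes> k m = \<one>" using u by (simp add: k_def)
    show "k m \<noteq> \<zero>" using k1 m by auto
    show "c m \<in> carrier R" "s m \<in> carrier R" using m kc by (simp_all add: c_def s_def)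
  qed
  have "{m \<in> carrier R. \<one> \<oplus> m \<otimes> m = \<zero>} \<subseteq> {m \<in> carrier R. m \<otimes> m = \<ominus> \<one>}"
    using minus_equality[of _ \<one>] a_comm[of \<one>] by auto
  hence "card {m \<in> carrier R. \<one> \<oplus> m \<otimes> m = \<zero>} \<le> card {m \<in> carrier R. m \<otimes> m = \<ominus> \<one>}"
    using assms(1) by (intro card_mono) auto
  also have "\<dots> \<le> 2" by (rule card_square_roots)
  finally have "card (carrier R - M) \<le> 2"
    by (simp add: M_def set_diff_eq cong: conj_cong)
  hence card_M: "card (carrier R) \<le> card M + 2"
    using assms(1) card_Diff_subset[of M "carrier R"] by (simp add: M_def)
  have "Q ` M \<subseteq> circle R t"
  proof (rule image_subsetI)
    fix m assume m: "m \<in> M"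
    have "c m \<otimes> c m \<oplus> s m \<otimes> s m = ((\<one> \<oplus> m \<otimes> m) \<otimes> k m) \<otimes> ((\<one> \<oplus> m \<otimes> m) \<otimes> k m)"
      unfolding c_def s_def using M(1,2)[OF m] by algebra
    hence 1: "c m \<otimes> c m \<oplus> s m \<otimes> s m = \<one>" unfolding M(3)[OF m] by simp
    have "sq_norm R (Q m) = (c m \<otimes> c m \<oplus> s m \<otimes> s m) \<otimes> (a \<otimes> a \<oplus> b \<otimes> b)"
      unfolding sq_norm_def Q_def fst_conv snd_conv using M(5,6)[OF m] ab(1,2) by algebra
    thus "Q m \<in> circle R t"
      unfolding 1 ab(3) using assms(3) M(5,6)[OF m] ab by (simp add: circle_def plane_def Q_def)
  qed
  moreover have "inj_on Q M"
  proof (rule inj_onI)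
    fix m m' assume m: "m \<in> M" "m' \<in> M" and Q: "Q m = Q m'"
    have rec: "t \<otimes> c m = a \<otimes> fst (Q m) \<oplus> b \<otimes> snd (Q m)" "t \<otimes> s m = a \<otimes> snd (Q m) \<ominus> b \<otimes> fst (Q m)"
      if "m \<in> M" for m
    proof -
      show "t \<otimes> c m = a \<otimes> fst (Q m) \<oplus> b \<otimes> snd (Q m)"
        unfolding Q_def fst_conv snd_conv ab(3)[symmetric] using M(5,6)[OF that] ab(1,2) by algebra
      show "t \<otimes> s m = a \<otimes> snd (Q m) \<ominus> b \<otimes> fst (Q m)"
        unfolding Q_def fst_conv snd_conv ab(3)[symmetric] using M(5,6)[OF that] ab(1,2) by algebra
    qed
    have cs: "c m = c m'" "s m = s m'"
      using rec[OF m(1)] rec[OF m(2)] Q assms(3,4) M(5,6)[OF m(1)] M(5,6)[OF m(2)]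
        cancel_left[of t] by metis+
    \<comment> \<open>The parameter is the slope s / (1 + c), and 1 + c = 2k is nonzero.\<close>
    have c: "\<one> \<oplus> c m = two \<otimes> k m" if "m \<in> M" for m
    proof -
      have "\<one> \<oplus> c m = (\<one> \<oplus> m \<otimes> m) \<otimes> k m \<oplus> c m" using M(3)[OF that] by simp
      also have "\<dots> = two \<otimes> k m" unfolding c_def using M(1,2)[OF that] by algebra
      finally show ?thesis .
    qed
    have "two \<otimes> k m = two \<otimes> k m'" using c[OF m(1)] c[OF m(2)] cs by simp
    hence k: "k m = k m'" using 2 M(2)[OF m(1)] M(2)[OF m(2)] cancel_left[of two] by simp
    have "(two \<otimes> k m) \<otimes> m = s m" "(two \<otimes> k m') \<otimes> m' = s m'"
      unfolding s_def using M(1,2)[OF m(1)] M(1,2)[OF m(2)] by algebra+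
    hence "(two \<otimes> k m) \<otimes> m = (two \<otimes> k m) \<otimes> m'" using cs k by simp
    moreover have "two \<otimes> k m \<noteq> \<zero>" using 2 M(2,4)[OF m(1)] integral by blast
    ultimately show "m = m'"
      using cancel_left[of "two \<otimes> k m" m m'] M(1,2)[OF m(1)] M(1)[OF m(2)] by simp
  qed
  moreover have "finite (circle R t)" using assms(1) by (auto simp: circle_def plane_def)
  ultimately have "card M \<le> card (circle R t)" by (intro card_inj_on_le)
  with card_M show ?thesis by linarith
qed

text \<open>Since \<open>s\<close> is a square root of 3, the rotation by 60 degrees is defined over the field.\<close>

lemma equilateral_triangle:
  assumes "two \<noteq> \<zero>" and s: "s \<in> carrier R" "s \<otimes> s = two \<oplus> \<one>" and x: "x \<in> circle R t"
  shows "\<exists>z\<in>circle R t. plane_minus R x z \<in> circle R t"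
proof -
  obtain x1 x2 where xx: "x = (x1, x2)" by fastforce
  have xc: "x1 \<in> carrier R" "x2 \<in> carrier R" and t: "t = x1 \<otimes> x1 \<oplus> x2 \<otimes> x2"
    using x unfolding xx by (auto simp: circle_def plane_def sq_norm_def)
  define h where "h = inv two"
  have "two \<in> Units R" using assms(1) by (simp add: field_Units)
  hence h: "h \<in> carrier R" "two \<otimes> h = \<one>" by (simp_all add: h_def)
  define z1 z2 where "z1 = h \<otimes> (x1 \<ominus> s \<otimes> x2)" and "z2 = h \<otimes> (s \<otimes> x1 \<oplus> x2)"
  have zc: "z1 \<in> carrier R" "z2 \<in> carrier R" using xc s h by (simp_all add: z1_def z2_def)
  have four: "h \<otimes> h \<otimes> (\<one> \<oplus> s \<otimes> s) = \<one>"
  proof -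
    have "h \<otimes> h \<otimes> (\<one> \<oplus> s \<otimes> s) = (two \<otimes> h) \<otimes> (two \<otimes> h)"
      unfolding s(2) using h(1) by algebra
    thus ?thesis unfolding h(2) by simp
  qed
  have "z1 \<otimes> z1 \<oplus> z2 \<otimes> z2 = h \<otimes> h \<otimes> (\<one> \<oplus> s \<otimes> s) \<otimes> t"
    unfolding z1_def z2_def t using xc h(1) s(1) by algebra
  hence "z1 \<otimes> z1 \<oplus> z2 \<otimes> z2 = t" unfolding four using xc by (simp add: t)
  hence "(z1, z2) \<in> circle R t" using zc by (simp add: circle_def plane_def sq_norm_def)
  \<comment> \<open>While z is x rotated by 60 degrees, with cosine h and sine h s, the difference x
    - z is x rotated by -60 degrees and so has the same norm.\<close>
  moreover have "x1 \<ominus> z1 = h \<otimes> (x1 \<oplus> s \<otimes> x2)"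
  proof -
    have "x1 \<ominus> z1 = (two \<otimes> h) \<otimes> x1 \<ominus> z1" unfolding h(2) using xc by simp
    also have "\<dots> = h \<otimes> (x1 \<oplus> s \<otimes> x2)" unfolding z1_def using xc h(1) s(1) by algebra
    finally show ?thesis .
  qed
  moreover have "x2 \<ominus> z2 = h \<otimes> (x2 \<ominus> s \<otimes> x1)"
  proof -
    have "x2 \<ominus> z2 = (two \<otimes> h) \<otimes> x2 \<ominus> z2" unfolding h(2) using xc by simp
    also have "\<dots> = h \<otimes> (x2 \<ominus> s \<otimes> x1)" unfolding z2_def using xc h(1) s(1) by algebra
    finally show ?thesis .
  qed
  moreover have "(h \<otimes> (x1 \<oplus> s \<otimes> x2)) \<otimes> (h \<otimes> (x1 \<oplus> s \<otimes> x2)) \<oplus>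
      (h \<otimes> (x2 \<ominus> s \<otimes> x1)) \<otimes> (h \<otimes> (x2 \<ominus> s \<otimes> x1)) = t"
  proof -
    have "(h \<otimes> (x1 \<oplus> s \<otimes> x2)) \<otimes> (h \<otimes> (x1 \<oplus> s \<otimes> x2)) \<oplus>
        (h \<otimes> (x2 \<ominus> s \<otimes> x1)) \<otimes> (h \<otimes> (x2 \<ominus> s \<otimes> x1)) = h \<otimes> h \<otimes> (\<one> \<oplus> s \<otimes> s) \<otimes> t"
      unfolding t using xc h(1) s(1) by algebra
    thus ?thesis unfolding four using xc by (simp add: t)
  qed
  moreover have "h \<otimes> (x1 \<oplus> s \<otimes> x2) \<in> carrier R" "h \<otimes> (x2 \<ominus> s \<otimes> x1) \<in> carrier R"
    using xc s h by simp_all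
  ultimately show ?thesis
    by (intro bexI[of _ "(z1, z2)"])
      (auto simp: xx plane_minus_def circle_def plane_def sq_norm_def)
qed

lemma circle_minus_swap:
  assumes "x \<in> plane R" "y \<in> plane R"
  shows "plane_minus R x y \<in> circle R t \<longleftrightarrow> plane_minus R y x \<in> circle R t"
proof -
  have "(a \<ominus> b) \<otimes> (a \<ominus> b) = (b \<ominus> a) \<otimes> (b \<ominus> a)"
    if "a \<in> carrier R" "b \<in> carrier R" for a b
    using that by algebra
  hence "sq_norm R (plane_minus R x y) = sq_norm R (plane_minus R y x)"
    using assms by (auto simp: plane_def sq_norm_def plane_minus_def)
  thus ?thesis using assms plane_minus_closed by (simp add: circle_def)
qed

end

section \<open>Bounds for the operator\<close>

text \<open>The real value of 1/p, which turns the region into linear inequalities over the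
  reals.\<close>

definition recip :: "ereal \<Rightarrow> real" where
  "recip p = (if p = \<infinity> then 0 else 1 / real_of_ereal p)"

lemma recip_nonneg: "1 \<le> p \<Longrightarrow> 0 \<le> recip p"
  by (cases p) (auto simp: recip_def)

lemma recip_le_1: "1 \<le> p \<Longrightarrow> recip p \<le> 1"
  by (cases p) (auto simp: recip_def)

lemma divide_eq_recip: "1 \<le> p \<Longrightarrow> ereal c / p = ereal (c * recip p)"
  by (cases p) (auto simp: recip_def)

lemma K3_region_iff_recip:
  assumes "1 \<le> p\<^sub>1" "1 \<le> p\<^sub>2" "1 \<le> p\<^sub>3"
  shows "K3_region p\<^sub>1 p\<^sub>2 p\<^sub>3 \<longleftrightarrow>
    2 * recip p\<^sub>1 + recip p\<^sub>2 + recip p\<^sub>3 \<le> 2 \<and>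
    recip p\<^sub>1 + 2 * recip p\<^sub>2 + recip p\<^sub>3 \<le> 2 \<and>
    recip p\<^sub>1 + recip p\<^sub>2 + 2 * recip p\<^sub>3 \<le> 2"
proof -
  have "1 / p = ereal (recip p)" "2 / p = ereal (2 * recip p)" if "1 \<le> p" for p
    using divide_eq_recip[OF that, of 1] divide_eq_recip[OF that, of 2] by (simp_all add: one_ereal_def)
  moreover have "ereal c \<le> 2 \<longleftrightarrow> c \<le> 2" for c
    using ereal_less_eq(3)[of c 2] by simp
  ultimately show ?thesis
    unfolding K3_region_def using assms by simp
qed

text \<open>For finite p the density is the p-th power of |f| divided by its norm, with equality. At
  infinity the exponent is 0 and the density is constant 1, so only a majorant remains.\<close>

lemma Lp_norm_majorant:
  assumes F: "finite (carrier F)" "carrier F \<noteq> {}" and p: "1 \<le> p"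
    and f: "\<And>x. x \<in> plane F \<Longrightarrow> 0 \<le> f x" and pos: "0 < Lp_norm F p f"
  obtains G where "\<And>x. 0 \<le> G x" "sum G (plane F) \<le> (real (card (carrier F)))\<^sup>2"
    "\<And>x. x \<in> plane F \<Longrightarrow> f x \<le> Lp_norm F p f * G x powr recip p"
proof (cases "p = \<infinity>")
  case True
  show thesis
  proof (rule that[of "\<lambda>_. 1"])
    fix x assume "x \<in> plane F"
    hence "\<bar>f x\<bar> \<le> Lp_norm F p f"
      using True F plane_finite_card(1)[of F] by (auto simp: Lp_norm_def intro!: Max_ge)
    thus "f x \<le> Lp_norm F p f * 1 powr recip p" by simp
  qed (use F in \<open>simp_all add: plane_finite_card\<close>)
next
  case False
  then obtain r where r: "p = ereal r" using p by (cases p) auto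
  with p have r1: "1 \<le> r" by simp
  define M where "M = Lp_norm F p f"
  define S where "S = (\<Sum>x\<in>plane F. \<bar>f x\<bar> powr r)"
  have q0: "0 < real (card (carrier F))" using F by (simp add: card_gt_0_iff)
  have S0: "0 \<le> S" unfolding S_def by (intro sum_nonneg) auto
  have M: "M = (1 / (real (card (carrier F)))\<^sup>2 * S) powr (1 / r)"
    by (simp add: M_def Lp_norm_def r S_def)
  have M0: "0 < M" using pos by (simp add: M_def)
  have Mr: "M powr r = S / (real (card (carrier F)))\<^sup>2"
    unfolding M using r1 S0 by (simp add: powr_powr)
  show thesis
  proof (rule that[of "\<lambda>x. \<bar>f x / M\<bar> powr r"])
    have "(\<Sum>x\<in>plane F. \<bar>f x / M\<bar> powr r) = S / M powr r"
      unfolding S_def sum_divide_distrib using M0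
      by (intro sum.cong refl) (simp add: abs_divide powr_divide)
    also have "\<dots> = (real (card (carrier F)))\<^sup>2"
      using M0 Mr q0 by (auto simp: field_simps)
    finally show "(\<Sum>x\<in>plane F. \<bar>f x / M\<bar> powr r) \<le> (real (card (carrier F)))\<^sup>2" by simp
  next
    fix x assume "x \<in> plane F"
    hence "(\<bar>f x / M\<bar> powr r) powr recip p = f x / M"
      using f[of x] M0 r1 by (simp add: recip_def r powr_powr)
    thus "f x \<le> Lp_norm F p f * (\<bar>f x / M\<bar> powr r) powr recip p"
      using M0 by (simp add: M_def)
  qed auto
qed

lemma admissible_field_facts:
  assumes "admissible_field F"
  shows "field F" "finite (carrier F)" "odd (card (carrier F))" "carrier F \<noteq> {}"
    "3 \<le> card (carrier F)"
proof -
  show F: "field F" "finite (carrier F)" using assms by (auto simp: admissible_field_def)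
  obtain p k :: nat where p: "odd p" "card (carrier F) = p ^ k"
    using assms by (auto simp: admissible_field_def)
  thus odd: "odd (card (carrier F))" by simp
  interpret field F by fact
  show "carrier F \<noteq> {}" by blast
  have "card {\<zero>\<^bsub>F\<^esub>, \<one>\<^bsub>F\<^esub>} \<le> card (carrier F)"
    using F by (intro card_mono) auto
  hence "2 \<le> card (carrier F)" by simp
  moreover have "card (carrier F) \<noteq> 2" using odd by auto
  ultimately show "3 \<le> card (carrier F)" by linarith
qed

text \<open>Cut off outside the plane, because the assumptions of \<open>triangle_kernel\<close>
  range over all points of the type.\<close>

definition adjacency :: "('a, 'm) ring_scheme \<Rightarrow> 'a \<Rightarrow> 'a \<times> 'a \<Rightarrow> 'a \<times> 'a \<Rightarrow> real" where
  "adjacency F t x y = of_bool (x \<in> plane F \<and> y \<in> plane F \<and> plane_minus F x y \<in> circle F t)"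

lemma triangle_kernel_adjacency:
  assumes "admissible_field F" "t \<in> carrier F" "t \<noteq> \<zero>\<^bsub>F\<^esub>"
  shows "triangle_kernel (plane F) (adjacency F t) (real (card (carrier F)))"
proof -
  note F = admissible_field_facts[OF assms(1)]
  interpret field F by (rule F)
  have fin: "finite (plane F)" using F by (simp add: plane_finite_card)
  have swap: "adjacency F t x y = adjacency F t y x" for x y
    using circle_minus_swap[of x y t] by (auto simp: adjacency_def)
  show ?thesis
  proof
    show "finite (plane F)" by fact
    show "1 \<le> real (card (carrier F))" using F(5) by simp
    show "real (card (plane F)) \<le> (real (card (carrier F)))\<^sup>2"
      using F by (simp add: plane_finite_card)
    show "adjacency F t x y = 0 \<or> adjacency F t x y = 1" for x y
      by (simp add: adjacency_def)
    show "adjacency F t x y = adjacency F t y x" for x y by (rule swap)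
    show "adjacency F t x x = 0" for x
      using assms by (auto simp: adjacency_def plane_def plane_minus_def circle_def sq_norm_def a_minus_def r_neg)
    show "(\<Sum>y\<in>plane F. adjacency F t x y) \<le> 2 * real (card (carrier F))" for x
    proof (cases "x \<in> plane F")
      case True
      let ?A = "{y \<in> plane F. plane_minus F y x \<in> circle F t}"
      have "(\<Sum>y\<in>plane F. adjacency F t x y) = (\<Sum>y\<in>plane F. adjacency F t y x)"
        by (intro sum.cong refl swap)
      also have "\<dots> = real (card ?A)"
        using True fin by (simp add: adjacency_def Int_def)
      also have "card ?A \<le> card (circle F t)"
      proof (rule card_inj_on_le)
        show "inj_on (\<lambda>y. plane_minus F y x) ?A"
          using True by (auto simp: inj_on_def plane_minus_def plane_def a_minus_def)
        show "finite (circle F t)" using fin by (simp add: circle_def)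
      qed auto
      also have "\<dots> \<le> 2 * card (carrier F)"
        by (intro card_circle_le F assms)
      finally show ?thesis by simp
    next
      case False
      thus ?thesis by (simp add: adjacency_def)
    qed
    show "(\<Sum>x\<in>plane F. adjacency F t x y * adjacency F t x y') \<le> 2" if "y \<noteq> y'" for y y'
    proof (cases "y \<in> plane F \<and> y' \<in> plane F")
      case True
      have "(\<Sum>x\<in>plane F. adjacency F t x y * adjacency F t x y') =
          real (card {x \<in> plane F. plane_minus F x y \<in> circle F t \<and> plane_minus F x y' \<in> circle F t})"
        using True fin by (simp add: adjacency_def Int_def flip: of_bool_conj)
      also have "\<dots> \<le> real 2"
        using True that assms F two_nonzero by (intro of_nat_mono circles_meet) auto
      finally show ?thesis by simp
    next
      case False
      thus ?thesis by (auto simp: adjacency_def)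
    qed
  qed
qed

section \<open>Sufficiency\<close>

lemma K3_bound_region:
  assumes F: "admissible_field F" and t: "t \<in> carrier F" "t \<noteq> \<zero>\<^bsub>F\<^esub>"
    and p: "1 \<le> p\<^sub>1" "1 \<le> p\<^sub>2" "1 \<le> p\<^sub>3" and region: "K3_region p\<^sub>1 p\<^sub>2 p\<^sub>3"
  shows "K3_bound F t p\<^sub>1 p\<^sub>2 p\<^sub>3 813"
  unfolding K3_bound_def
proof (intro allI impI)
  fix f g h :: "'a \<times> 'a \<Rightarrow> real"
  assume nn: "\<forall>x\<in>plane F. 0 \<le> f x \<and> 0 \<le> g x \<and> 0 \<le> h x"
  note FF = admissible_field_facts[OF F]
  interpret field F by (rule FF)
  interpret triangle_kernel "plane F" "adjacency F t" "real (card (carrier F))"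
    by (intro triangle_kernel_adjacency F t)
  define q n where "q = real (card (carrier F))" and "n = real (card (circle F t))"
  define M1 M2 M3 where "M1 = Lp_norm F p\<^sub>1 f" and "M2 = Lp_norm F p\<^sub>2 g" and "M3 = Lp_norm F p\<^sub>3 h"
  have q3: "3 \<le> q" using FF(5) by (simp add: q_def)
  have "q \<le> n + 2"
    using card_circle_ge[OF FF(2,3) t] by (simp add: q_def n_def)
  \<comment> \<open>From q \<ge> 3 the circle has at least one point, so n + 2 \<le> 3 n. This
    factor turns 271 into 813.\<close>
  hence n: "q \<le> 3 * n" using q3 by simp
  have form: "K3_form F t f g h =
      1 / (q\<^sup>2 * n) * (\<Sum>x\<in>plane F. \<Sum>y\<in>plane F. \<Sum>z\<in>plane F. w x y z * (f x * g y * h z))"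
    unfolding K3_form_def q_def n_def
    by (intro arg_cong2[of _ _ _ _ "(*)"] refl sum.cong) (simp add: w_def adjacency_def indicator_def)
  have M0: "0 \<le> M1" "0 \<le> M2" "0 \<le> M3"
    unfolding M1_def M2_def M3_def by (intro Lp_norm_nonneg FF)+
  show "K3_form F t f g h \<le> 813 * (Lp_norm F p\<^sub>1 f * Lp_norm F p\<^sub>2 g * Lp_norm F p\<^sub>3 h)"
  \<comment> \<open>A function of norm 0 cannot be normalised, but it vanishes on the plane.\<close>
  proof (cases "M1 = 0 \<or> M2 = 0 \<or> M3 = 0")
    case True
    have "f x * g y * h z = 0" if "x \<in> plane F" "y \<in> plane F" "z \<in> plane F" for x y z
      using True abs_le_Lp_norm[OF FF(2) p(1) that(1), of f] abs_le_Lp_norm[OF FF(2) p(2) that(2), of g]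
        abs_le_Lp_norm[OF FF(2) p(3) that(3), of h] by (auto simp: M1_def M2_def M3_def)
    hence "(\<Sum>x\<in>plane F. \<Sum>y\<in>plane F. \<Sum>z\<in>plane F. w x y z * (f x * g y * h z)) = 0"
      by (intro sum.neutral ballI) (simp only: mult_zero_right)
    hence "K3_form F t f g h = 0" unfolding form by simp
    with M0 show ?thesis by (simp add: M1_def M2_def M3_def)
  next
    case False
    hence M: "0 < M1" "0 < M2" "0 < M3" using M0 by auto
    obtain F1 where F1: "\<And>x. 0 \<le> F1 x" "sum F1 (plane F) \<le> (real (card (carrier F)))\<^sup>2"
        "\<And>x. x \<in> plane F \<Longrightarrow> f x \<le> M1 * F1 x powr recip p\<^sub>1"
      using Lp_norm_majorant[OF FF(2,4) p(1), of f] nn M(1) unfolding M1_def by blast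
    obtain G1 where G1: "\<And>x. 0 \<le> G1 x" "sum G1 (plane F) \<le> (real (card (carrier F)))\<^sup>2"
        "\<And>x. x \<in> plane F \<Longrightarrow> g x \<le> M2 * G1 x powr recip p\<^sub>2"
      using Lp_norm_majorant[OF FF(2,4) p(2), of g] nn M(2) unfolding M2_def by blast
    obtain H1 where H1: "\<And>x. 0 \<le> H1 x" "sum H1 (plane F) \<le> (real (card (carrier F)))\<^sup>2"
        "\<And>x. x \<in> plane F \<Longrightarrow> h x \<le> M3 * H1 x powr recip p\<^sub>3"
      using Lp_norm_majorant[OF FF(2,4) p(3), of h] nn M(3) unfolding M3_def by blast
    let ?c = "\<lambda>x y z. F1 x powr recip p\<^sub>1 * G1 y powr recip p\<^sub>2 * H1 z powr recip p\<^sub>3"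
    have "(\<Sum>x\<in>plane F. \<Sum>y\<in>plane F. \<Sum>z\<in>plane F. w x y z * (f x * g y * h z)) \<le>
        (\<Sum>x\<in>plane F. \<Sum>y\<in>plane F. \<Sum>z\<in>plane F. w x y z * ((M1 * F1 x powr recip p\<^sub>1) *
          (M2 * G1 y powr recip p\<^sub>2) * (M3 * H1 z powr recip p\<^sub>3)))"
      using nn M by (intro sum_mono mult_left_mono mult_mono F1 G1 H1 w_nonneg mult_nonneg_nonneg) auto
    also have "\<dots> = M1 * M2 * M3 * (\<Sum>x\<in>plane F. \<Sum>y\<in>plane F. \<Sum>z\<in>plane F. w x y z * ?c x y z)"
      unfolding sum_distrib_left by (intro sum.cong refl) (simp only: mult_ac)
    also have "\<dots> \<le> M1 * M2 * M3 * (271 * q ^ 3)"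
      unfolding q_def using M region p
      by (intro mult_left_mono triangles_powr F1 G1 H1 recip_nonneg) (auto simp: K3_region_iff_recip)
    finally have "K3_form F t f g h \<le> 1 / (q\<^sup>2 * n) * (M1 * M2 * M3 * (271 * q ^ 3))"
      unfolding form by (intro mult_left_mono) (auto simp: q_def n_def)
    also have "\<dots> = M1 * M2 * M3 * (271 * (q / n))"
      using q3 by (simp add: eval_nat_numeral)
    also have "\<dots> \<le> M1 * M2 * M3 * (271 * 3)"
      using M n q3 by (intro mult_left_mono) (auto simp: pos_divide_le_eq)
    finally show ?thesis by (simp add: M1_def M2_def M3_def)
  qed
qed

lemma K3_strong_region:
  assumes "1 \<le> p\<^sub>1" "1 \<le> p\<^sub>2" "1 \<le> p\<^sub>3" "K3_region p\<^sub>1 p\<^sub>2 p\<^sub>3"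
  shows "K3_strong p\<^sub>1 p\<^sub>2 p\<^sub>3"
  unfolding K3_strong_def
proof (intro exI[of _ 813] conjI allI impI ballI)
  fix F :: "nat ring" and t assume "admissible_field F" "t \<in> carrier F - {\<zero>\<^bsub>F\<^esub>}"
  thus "K3_const F t p\<^sub>1 p\<^sub>2 p\<^sub>3 \<le> 813"
    using assms admissible_field_facts by (intro K3_const_least K3_bound_region) auto
qed simp

lemma K3_restricted_2: "K3_restricted 2 2 2"
  unfolding K3_restricted_def
proof (intro exI[of _ 813] allI impI ballI)
  fix F :: "nat ring" and t and E G H
  assume "admissible_field F" "t \<in> carrier F - {\<zero>\<^bsub>F\<^esub>}"
  moreover have "K3_region 2 2 2"
    by (simp add: K3_region_iff_recip recip_def)
  ultimately have "K3_bound F t 2 2 2 813" by (intro K3_bound_region) auto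
  thus "K3_form F t (indicator E) (indicator G) (indicator H) \<le>
      813 * (Lp_norm F 2 (indicator E) * Lp_norm F 2 (indicator G) * Lp_norm F 2 (indicator H))"
    by (simp add: K3_bound_def)
qed

section \<open>Necessity: cyclic symmetry, large prime fields, test functions\<close>

lemma K3_form_rotate: "K3_form F t f g h = K3_form F t g h f"
proof -
  let ?I = "\<lambda>x y. indicator (circle F t) (plane_minus F x y) :: real"
  let ?P = "plane F"
  have "(\<Sum>x\<in>?P. \<Sum>y\<in>?P. \<Sum>z\<in>?P. ?I x y * ?I y z * ?I z x * (f x * g y * h z)) =
      (\<Sum>y\<in>?P. \<Sum>x\<in>?P. \<Sum>z\<in>?P. ?I x y * ?I y z * ?I z x * (f x * g y * h z))"
    by (rule sum.swap)
  also have "\<dots> = (\<Sum>y\<in>?P. \<Sum>z\<in>?P. \<Sum>x\<in>?P. ?I x y * ?I y z * ?I z x * (f x * g y * h z))"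
    by (intro sum.cong refl sum.swap)
  also have "\<dots> = (\<Sum>y\<in>?P. \<Sum>z\<in>?P. \<Sum>x\<in>?P. ?I y z * ?I z x * ?I x y * (g y * h z * f x))"
    by (intro sum.cong refl) (simp only: mult_ac)
  finally show ?thesis unfolding K3_form_def by simp
qed

lemma K3_bound_rotate: "K3_bound F t p\<^sub>1 p\<^sub>2 p\<^sub>3 C \<Longrightarrow> K3_bound F t p\<^sub>2 p\<^sub>3 p\<^sub>1 C"
  unfolding K3_bound_def
proof (intro allI impI)
  fix f g h :: "'a \<times> 'a \<Rightarrow> real"
  assume bound: "\<forall>f g h. (\<forall>x\<in>plane F. 0 \<le> f x \<and> 0 \<le> g x \<and> 0 \<le> h x) \<longrightarrow>
      K3_form F t f g h \<le> C * (Lp_norm F p\<^sub>1 f * Lp_norm F p\<^sub>2 g * Lp_norm F p\<^sub>3 h)"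
    and nn: "\<forall>x\<in>plane F. 0 \<le> f x \<and> 0 \<le> g x \<and> 0 \<le> h x"
  have "K3_form F t h f g \<le> C * (Lp_norm F p\<^sub>1 h * Lp_norm F p\<^sub>2 f * Lp_norm F p\<^sub>3 g)"
    using nn by (intro bound[rule_format]) auto
  thus "K3_form F t f g h \<le> C * (Lp_norm F p\<^sub>2 f * Lp_norm F p\<^sub>3 g * Lp_norm F p\<^sub>1 h)"
    by (simp only: K3_form_rotate[of F t h f g] mult_ac)
qed

text \<open>By this symmetry only the first inequality of the region has to be tested.\<close>

lemma K3_strong_rotate:
  assumes "K3_strong p\<^sub>1 p\<^sub>2 p\<^sub>3"
  shows "K3_strong p\<^sub>2 p\<^sub>3 p\<^sub>1"
proof -
  have "K3_bound F t p\<^sub>2 p\<^sub>3 p\<^sub>1 = K3_bound F t p\<^sub>1 p\<^sub>2 p\<^sub>3" for F :: "nat ring" and t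
    by (intro ext iffI) (blast intro: K3_bound_rotate)+
  with assms show ?thesis unfolding K3_strong_def K3_const_def by simp
qed

text \<open>Residues are represented by natural numbers because \<open>K3_strong\<close> ranges over
  \<open>nat ring\<close>.\<close>

definition prime_field :: "nat \<Rightarrow> nat ring" where
  "prime_field p = \<lparr>carrier = {..<p}, monoid.mult = (\<lambda>a b. a * b mod p), one = 1, zero = 0,
     add = (\<lambda>a b. (a + b) mod p)\<rparr>"

lemma field_prime_field:
  assumes "prime p"
  shows "field (prime_field p)"
proof -
  have p: "1 < p" using assms by (rule prime_gt_1_nat)
  have "cring (prime_field p)"
  proof (rule cringI)
    show "abelian_group (prime_field p)"
    proof (rule abelian_groupI)
      fix x assume x: "x \<in> carrier (prime_field p)"
      \<comment> \<open>The inner \<open>mod\<close> is for x = 0, where p - x lies outside the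
        carrier.\<close>
      have "((p - x) mod p + x) mod p = 0" using x by (simp add: prime_field_def mod_simps)
      thus "\<exists>y\<in>carrier (prime_field p). y \<oplus>\<^bsub>prime_field p\<^esub> x = \<zero>\<^bsub>prime_field p\<^esub>"
        using p by (intro bexI[of _ "(p - x) mod p"]) (auto simp: prime_field_def)
    qed (use p in \<open>auto simp: prime_field_def mod_simps add_ac\<close>)
    show "comm_monoid (prime_field p)"
      by (rule comm_monoidI) (use p in \<open>auto simp: prime_field_def mod_simps mult_ac\<close>)
  qed (use p in \<open>auto simp: prime_field_def mod_simps algebra_simps\<close>)
  then interpret cring "prime_field p" .
  have "Units (prime_field p) = carrier (prime_field p) - {\<zero>\<^bsub>prime_field p\<^esub>}"
  proof (intro equalityI subsetI)
    fix x assume x: "x \<in> Units (prime_field p)"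
    then obtain y where "x * y mod p = 1" "x < p" by (auto simp: Units_def prime_field_def mult.commute)
    thus "x \<in> carrier (prime_field p) - {\<zero>\<^bsub>prime_field p\<^esub>}"
      by (auto simp: prime_field_def intro!: gr0I)
  next
    fix x assume "x \<in> carrier (prime_field p) - {\<zero>\<^bsub>prime_field p\<^esub>}"
    hence x: "0 < x" "x < p" by (auto simp: prime_field_def)
    hence "coprime x p"
      using assms by (metis coprime_commute nat_dvd_not_less prime_imp_coprime)
    then obtain y where "[x * y = 1] (mod p)" using cong_solve_coprime_nat by auto
    hence "x * (y mod p) mod p = 1" using p by (simp add: cong_def mod_simps)
    thus "x \<in> Units (prime_field p)"
      using x p by (auto simp: Units_def prime_field_def mult.commute intro!: exI[of _ "y mod p"])
  qed
  thus ?thesis by (rule cring_fieldI)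
qed

text \<open>The square root of 3 is 3k, since its square is 3 times 3k^2; as 3 < p, the residue 3 is
  nonzero.\<close>

lemma admissible_prime_field:
  assumes "prime p" "3 < p" and k: "3 * k\<^sup>2 mod p = 1"
  shows "admissible_field (prime_field p)"
proof -
  have "(3 * k mod p) * (3 * k mod p) mod p = 3 * (3 * k\<^sup>2) mod p"
    unfolding mod_mult_eq by (simp add: power2_eq_square mult_ac)
  also have "\<dots> = 3 * (3 * k\<^sup>2 mod p) mod p"
    by (simp only: mod_mult_right_eq)
  also have "\<dots> = 3" using assms by simp
  finally have s: "(3 * k mod p) * (3 * k mod p) mod p = 3" .
  have three: "\<one>\<^bsub>prime_field p\<^esub> \<oplus>\<^bsub>prime_field p\<^esub> \<one>\<^bsub>prime_field p\<^esub> \<oplus>\<^bsub>prime_field p\<^esub> \<one>\<^bsub>prime_field p\<^esub> = 3"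
    using assms(2) by (simp add: prime_field_def)
  have "3 * k mod p \<in> carrier (prime_field p)" using assms(2) by (simp add: prime_field_def)
  moreover have "3 * k mod p \<otimes>\<^bsub>prime_field p\<^esub> (3 * k mod p) = 3" using s by (simp add: prime_field_def)
  moreover have "\<zero>\<^bsub>prime_field p\<^esub> = 0" by (simp add: prime_field_def)
  moreover have "odd p" using assms prime_odd_nat by auto
  moreover have "card (carrier (prime_field p)) = p ^ 1" "finite (carrier (prime_field p))"
    by (simp_all add: prime_field_def)
  ultimately show ?thesis
    unfolding admissible_field_def three using field_prime_field[OF assms(1)] assms(1)
    by (metis zero_less_one zero_neq_numeral)
qed

text \<open>Euclid's argument: every prime factor of \<open>3 * (fact m)\<^sup>2 - 1\<close> exceeds \<open>m\<close>, and 3 is a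
  square modulo it.\<close>

lemma large_admissible_field:
  obtains F :: "nat ring" where "admissible_field F" "N < card (carrier F)"
proof -
  \<comment> \<open>At least 3, so that the prime found exceeds 3 as
    \<open>admissible_prime_field\<close> demands.\<close>
  define m where "m = max N 3"
  define k where "k = (fact m :: nat)"
  have k1: "1 \<le> k\<^sup>2" by (simp add: k_def)
  hence "3 * k\<^sup>2 - 1 \<noteq> 1" by linarith
  then obtain p where p: "prime p" "p dvd 3 * k\<^sup>2 - 1" using prime_factor_nat by blast
  have "m < p"
  proof (rule ccontr)
    assume "\<not> m < p"
    hence "p dvd k" using p(1) by (simp add: k_def prime_dvd_fact_iff)
    hence "p dvd 3 * k\<^sup>2" by (simp add: power2_eq_square)
    with p(2) k1 have "p dvd 1" by (metis dvd_diffD1 le_trans mult_le_mono nat_mult_1 one_le_numeral)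
    with p(1) show False by simp
  qed
  moreover have "3 * k\<^sup>2 mod p = 1"
  proof -
    obtain c where "3 * k\<^sup>2 - 1 = p * c" using p(2) by (rule dvdE)
    hence "3 * k\<^sup>2 = 1 + p * c" using k1 by linarith
    thus ?thesis using prime_gt_1_nat[OF p(1)] by (simp only: mod_mult_self2 mod_less)
  qed
  ultimately show thesis
    using p(1) by (intro that[of "prime_field p"] admissible_prime_field[where k = k])
      (auto simp: m_def prime_field_def)
qed

text \<open>At infinity the right side is a power with exponent 0, which equals 1 because E is
  nonempty.\<close>

lemma Lp_norm_indicator_le:
  assumes "finite (carrier F)" "E \<subseteq> plane F" "E \<noteq> {}" "1 \<le> p"
  shows "Lp_norm F p (indicator E) \<le> (real (card E) / (real (card (carrier F)))\<^sup>2) powr recip p"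
proof -
  have fin: "finite (plane F)" "finite E"
    using assms plane_finite_card finite_subset by blast+
  have ne: "carrier F \<noteq> {}" using assms by (auto simp: plane_def)
  show ?thesis
  proof (cases "p = \<infinity>")
    case True
    have "Max ((\<lambda>x. \<bar>indicator E x :: real\<bar>) ` plane F) \<le> 1"
      using assms fin by (intro Max.boundedI) (auto simp: indicator_def)
    thus ?thesis using True assms fin ne by (simp add: Lp_norm_def recip_def)
  next
    case False
    then obtain r where r: "p = ereal r" using assms by (cases p) auto
    have "(\<Sum>x\<in>plane F. \<bar>indicator E x\<bar> powr r) = (\<Sum>x\<in>plane F. indicator E x :: real)"
      by (intro sum.cong refl) (simp add: indicator_def)
    also have "\<dots> = real (card E)"
      using sum.mono_neutral_right[OF fin(1) assms(2), of "indicator E :: _ \<Rightarrow> real"] by simp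
    finally show ?thesis using r by (simp add: Lp_norm_def recip_def)
  qed
qed

text \<open>Every point of the circle lies in an equilateral triangle with the centre and another
  point of the circle. These n triangles cancel the factor 1/n, so the form is at least q^-2, while
  the product of norms is at most 4 q^-(\<delta> + 2). Hence q^\<delta> \<le> 4C.\<close>

lemma K3_strong_imp:
  assumes p: "1 \<le> p\<^sub>1" "1 \<le> p\<^sub>2" "1 \<le> p\<^sub>3" and strong: "K3_strong p\<^sub>1 p\<^sub>2 p\<^sub>3"
  shows "2 * recip p\<^sub>1 + recip p\<^sub>2 + recip p\<^sub>3 \<le> 2"
proof (rule ccontr)
  assume not: "\<not> ?thesis"
  define \<delta> where "\<delta> = 2 * recip p\<^sub>1 + recip p\<^sub>2 + recip p\<^sub>3 - 2"
  have \<delta>: "0 < \<delta>" using not by (simp add: \<delta>_def)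
  obtain C where C: "1 \<le> C" "\<And>F :: nat ring. \<And>t. admissible_field F \<Longrightarrow> t \<in> carrier F - {\<zero>\<^bsub>F\<^esub>} \<Longrightarrow>
      K3_const F t p\<^sub>1 p\<^sub>2 p\<^sub>3 \<le> C"
    using strong by (auto simp: K3_strong_def)
  \<comment> \<open>The threshold is the q at which q^\<delta> reaches 4C.\<close>
  obtain F :: "nat ring" where F: "admissible_field F"
      and large: "nat \<lceil>(4 * C) powr (1 / \<delta>)\<rceil> < card (carrier F)"
    by (rule large_admissible_field)
  note FF = admissible_field_facts[OF F]
  interpret field F by (rule FF)
  define S where "S = circle F \<one>\<^bsub>F\<^esub>"
  define o' where "o' = (\<zero>\<^bsub>F\<^esub>, \<zero>\<^bsub>F\<^esub>)"
  define q n where "q = real (card (carrier F))" and "n = real (card S)"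
  have q0: "0 < q" using FF(5) by (simp add: q_def)
  have o': "o' \<in> plane F" by (simp add: o'_def plane_def)
  have fin: "finite (plane F)" using FF by (simp add: plane_finite_card)
  have SP: "S \<subseteq> plane F" by (auto simp: S_def circle_def)
  have one_S: "(\<one>\<^bsub>F\<^esub>, \<zero>\<^bsub>F\<^esub>) \<in> S" by (simp add: S_def circle_def plane_def sq_norm_def)
  hence S: "S \<noteq> {}" "finite S" using SP fin finite_subset by auto
  hence n0: "0 < n" by (simp add: n_def card_gt_0_iff)
  have n2: "n \<le> 2 * q" using card_circle_le[OF FF(2), of "\<one>\<^bsub>F\<^esub>"] by (simp add: n_def q_def S_def)
  have minus_o': "plane_minus F x o' = x" if "x \<in> plane F" for x
    using that by (auto simp: plane_def plane_minus_def o'_def a_minus_def)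
  obtain s where s: "s \<in> carrier F" "s \<otimes>\<^bsub>F\<^esub> s = two \<oplus>\<^bsub>F\<^esub> \<one>\<^bsub>F\<^esub>"
    using F by (auto simp: admissible_field_def)
  let ?f = "indicator {o'} :: nat \<times> nat \<Rightarrow> real" and ?g = "indicator S :: nat \<times> nat \<Rightarrow> real"
  let ?I = "\<lambda>x y. indicator S (plane_minus F x y) :: real"
  have "n = (\<Sum>y\<in>S. 1)" by (simp add: n_def)
  also have "\<dots> \<le> (\<Sum>y\<in>S. \<Sum>z\<in>plane F. ?I o' y * ?I y z * ?I z o' * (?f o' * ?g y * ?g z))"
  proof (rule sum_mono)
    fix y assume y: "y \<in> S"
    obtain z where z: "z \<in> S" "plane_minus F y z \<in> S"
      using equilateral_triangle[OF two_nonzero[OF FF(3)] s] y unfolding S_def by blast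
    \<comment> \<open>The form takes differences in cyclic order, so here y occurs negated.\<close>
    have "plane_minus F o' y \<in> S"
      using circle_minus_swap[of o' y "\<one>\<^bsub>F\<^esub>"] o' y SP minus_o'[of y] by (auto simp: S_def)
    hence "1 = ?I o' y * ?I y z * ?I z o' * (?f o' * ?g y * ?g z)"
      using y z SP minus_o'[of z] by auto
    also have "\<dots> \<le> (\<Sum>z\<in>plane F. ?I o' y * ?I y z * ?I z o' * (?f o' * ?g y * ?g z))"
      using z SP fin by (intro member_le_sum) auto
    finally show "1 \<le> (\<Sum>z\<in>plane F. ?I o' y * ?I y z * ?I z o' * (?f o' * ?g y * ?g z))" .
  qed
  also have "\<dots> \<le> (\<Sum>y\<in>plane F. \<Sum>z\<in>plane F. ?I o' y * ?I y z * ?I z o' * (?f o' * ?g y * ?g z))"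
    using SP fin by (intro sum_mono2 sum_nonneg) auto
  also have "\<dots> \<le> (\<Sum>x\<in>plane F. \<Sum>y\<in>plane F. \<Sum>z\<in>plane F. ?I x y * ?I y z * ?I z x * (?f x * ?g y * ?g z))"
    using o' fin by (intro member_le_sum[where f = "\<lambda>x. \<Sum>y\<in>plane F. \<Sum>z\<in>plane F.
      ?I x y * ?I y z * ?I z x * (?f x * ?g y * ?g z)"] sum_nonneg) auto
  finally have "1 / (q\<^sup>2 * n) * n \<le> K3_form F \<one>\<^bsub>F\<^esub> ?f ?g ?g"
    unfolding K3_form_def S_def[symmetric] q_def[symmetric] n_def[symmetric]
    using q0 n0 by (intro mult_left_mono) auto
  hence "1 / q\<^sup>2 \<le> K3_form F \<one>\<^bsub>F\<^esub> ?f ?g ?g" using n0 by simp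
  also have "\<dots> \<le> K3_const F \<one>\<^bsub>F\<^esub> p\<^sub>1 p\<^sub>2 p\<^sub>3 * (Lp_norm F p\<^sub>1 ?f * Lp_norm F p\<^sub>2 ?g * Lp_norm F p\<^sub>3 ?g)"
    using K3_const_least(1)[OF FF(2,4) p] by (simp add: K3_bound_def)
  also have "\<dots> \<le> C * (Lp_norm F p\<^sub>1 ?f * Lp_norm F p\<^sub>2 ?g * Lp_norm F p\<^sub>3 ?g)"
    by (intro mult_right_mono C F mult_nonneg_nonneg Lp_norm_nonneg FF) simp
  also have "\<dots> \<le> C * ((1 / q\<^sup>2) powr recip p\<^sub>1 * (2 / q) powr recip p\<^sub>2 * (2 / q) powr recip p\<^sub>3)"
  proof -
    have g: "Lp_norm F p ?g \<le> (2 / q) powr recip p" if "1 \<le> p" for p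
    proof -
      have "Lp_norm F p ?g \<le> (n / q\<^sup>2) powr recip p"
        using Lp_norm_indicator_le[OF FF(2) SP S(1) that] by (simp add: n_def q_def)
      also have "\<dots> \<le> (2 / q) powr recip p"
        using n2 n0 q0 recip_nonneg[OF that]
        by (intro powr_mono2) (auto simp: field_simps power2_eq_square)
      finally show ?thesis .
    qed
    have "Lp_norm F p\<^sub>1 ?f \<le> (1 / q\<^sup>2) powr recip p\<^sub>1"
      using Lp_norm_indicator_le[OF FF(2), of "{o'}" p\<^sub>1] o' p by (simp add: q_def)
    thus ?thesis
      using C(1) g p by (intro mult_left_mono mult_mono mult_nonneg_nonneg Lp_norm_nonneg FF) auto
  qed
  also have "\<dots> = C * 2 powr (recip p\<^sub>2 + recip p\<^sub>3) * q powr - (\<delta> + 2)"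
  proof -
    have "(1 / q\<^sup>2) powr recip p\<^sub>1 = q powr (- 2 * recip p\<^sub>1)"
      using q0 by (simp add: powr_powr powr_minus_divide powr_divide flip: powr_numeral)
    moreover have "(2 / q) powr r = 2 powr r * q powr - r" for r
      using q0 by (simp add: powr_divide powr_minus_divide)
    ultimately show ?thesis
      by (simp add: \<delta>_def powr_add powr_diff powr_minus_divide)
  qed
  \<comment> \<open>The circle may have 2q points, which costs a factor 2 in each of its two norms
    at most, as the reciprocals are at most 1.\<close>
  also have "\<dots> \<le> C * 2 powr 2 * q powr - (\<delta> + 2)"
    using C(1) recip_le_1[OF p(2)] recip_le_1[OF p(3)]
    by (intro mult_right_mono mult_left_mono powr_mono) auto
  also have "\<dots> = 4 * C / q powr \<delta> / q\<^sup>2"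
    using q0 by (simp add: powr_minus_divide powr_diff powr_add)
  finally have "q powr \<delta> \<le> 4 * C"
    using q0 by (simp add: divide_le_cancel pos_le_divide_eq)
  moreover have "4 * C < q powr \<delta>"
  proof -
    have "(4 * C) powr (1 / \<delta>) < q" using large unfolding q_def by linarith
    hence "((4 * C) powr (1 / \<delta>)) powr \<delta> < q powr \<delta>" using \<delta> by (intro powr_less_mono2) auto
    thus ?thesis using \<delta> C(1) by (simp add: powr_powr)
  qed
  ultimately show False by simp
qed

theorem theorem4p11:
  fixes p\<^sub>1 p\<^sub>2 p\<^sub>3 :: ereal
  assumes "1 \<le> p\<^sub>1" and "1 \<le> p\<^sub>2" and "1 \<le> p\<^sub>3"
  shows "(K3_strong p\<^sub>1 p\<^sub>2 p\<^sub>3 \<longrightarrow> K3_region p\<^sub>1 p\<^sub>2 p\<^sub>3) \<and>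
         (K3_region p\<^sub>1 p\<^sub>2 p\<^sub>3 \<longrightarrow>
            ((p\<^sub>1, p\<^sub>2, p\<^sub>3) \<noteq> (2, 2, 2) \<longrightarrow> K3_strong p\<^sub>1 p\<^sub>2 p\<^sub>3) \<and>
            K3_restricted 2 2 2)"
proof -
  have "K3_region p\<^sub>1 p\<^sub>2 p\<^sub>3" if strong: "K3_strong p\<^sub>1 p\<^sub>2 p\<^sub>3"
  proof -
    note strong' = K3_strong_rotate[OF strong]
    show ?thesis
      using K3_strong_imp[OF assms strong] K3_strong_imp[OF assms(2,3,1) strong']
        K3_strong_imp[OF assms(3,1,2) K3_strong_rotate[OF strong']]
      by (simp add: K3_region_iff_recip[OF assms] algebra_simps)
  qed
  thus ?thesis using K3_strong_region[OF assms] K3_restricted_2 by blast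
qed

end
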